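(* Let $G$ be a totally disconnected locally compact group and let $(R,V)$ be a nonzero compact Hilbert representation of $G$. Then $R$ has an irreducible subquotient. Moreover, $R$ possesses a complete filtration, and it has finite multiplicities: $N(\pi)<\infty$ for every irreducible representation $\pi$ of $G$.
   Context: $C_c^\infty(G)$ denotes the space of locally constant, compactly supported functions on $G$. A Hilbert representation is a continuous representation on a Hilbert space; it is compact if for every $f\in C_c^\infty(G)$ the operator $R(f)=\int_G f(g)R(g)\,dg$ (Haar measure) is compact. Subrepresentation: closed $G$-invariant subspace; subquotient: $F/E$ for subrepresentations $E\subset F$; irreducible: nonzero with no closed invariant subspaces other than $0$ and itself. Two elements $a<b$ of an ordered set are neighbours if nothing lies strictly between them; for a linearly ordered $L$, $L_n$ is the set of elements having a neighbour; $L$ is a ladder if each $a\in L\setminus L_n$ equals $\sup\{b\in L_n:b<a\}$ and $\inf\{c\in L_n:a<c\}$. A complete filtration is a family $(F_a)_{a\in L}$ of subrepresentations indexed by a ladder $L$ with $F_a\subsetneq F_b$ for $a<b$, such that $F_b/F_a$ is irreducible whenever $a<b$ are neighbours, and $\overline{\bigcup_{a\in A}F_a}=\bigcap_{b\in B}F_b$ whenever $L=A\sqcup B$ with $A<B$. The multiplicity $N(\pi)$ of an irreducible $\pi$ is the supremum of all $k$ such that there are subrepresentations $F_1\subset\dots\subset F_{2k}$ with $F_{2j}/F_{2j-1}\cong\pi$ for all $j$.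
   Formalization: In a complete filtration, the condition on L = A ⊔ B is required only at cuts not between neighbours a<b, where it would force F_a = F_b; A or B may be empty (empty union 0, empty intersection V), so the filtration runs from 0 to V. *)

theory Defs
  imports "HOL-Analysis.Analysis" "HOL-Algebra.Coset"
begin

section \<open>Complex Hilbert spaces\<close>

text \<open>The real structure comes from the library classes; the inner product \<open>cinner\<close> is linear in
  its first argument. The norm is the one of \<open>cinner\<close>, as \<open>inner x x = Re (cinner x x)\<close>.\<close>

class complex_hilbert = real_inner + complete_space +
  fixes scaleC :: "complex \<Rightarrow> 'a \<Rightarrow> 'a" (infixr "*\<^sub>C" 75)
    and cinner :: "'a \<Rightarrow> 'a \<Rightarrow> complex"
  assumes scaleC_add_right: "c *\<^sub>C (x + y) = c *\<^sub>C x + c *\<^sub>C y"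
    and scaleC_add_left: "(c + d) *\<^sub>C x = c *\<^sub>C x + d *\<^sub>C x"
    and scaleC_scaleC: "c *\<^sub>C d *\<^sub>C x = (c * d) *\<^sub>C x"
    and scaleR_scaleC: "r *\<^sub>R x = complex_of_real r *\<^sub>C x"
    and cinner_add_left: "cinner (x + y) z = cinner x z + cinner y z"
    and cinner_scaleC_left: "cinner (c *\<^sub>C x) y = c * cinner x y"
    and cinner_commute: "cinner x y = cnj (cinner y x)"
    and inner_eq_Re_cinner: "inner x y = Re (cinner x y)"

section \<open>Totally disconnected locally compact groups and Haar measure\<close>

definition topological_group :: "('g, 'm) monoid_scheme \<Rightarrow> 'g topology \<Rightarrow> bool" where
  "topological_group G X \<longleftrightarrow>
     group G \<and> topspace X = carrier G \<and>
     continuous_map (prod_topology X X) X (\<lambda>(x, y). x \<otimes>\<^bsub>G\<^esub> y) \<and>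
     continuous_map X X (\<lambda>x. inv\<^bsub>G\<^esub> x)"

definition totally_disconnected_space :: "'a topology \<Rightarrow> bool" where
  "totally_disconnected_space X \<longleftrightarrow> (\<forall>C. connectedin X C \<longrightarrow> (\<exists>x. C \<subseteq> {x}))"

text \<open>A left Haar measure is a nonzero left invariant Radon measure. The group need not be
  \<open>\<sigma>\<close>-compact, so inner regularity is required for open sets only.\<close>

definition haar_measure :: "('g, 'm) monoid_scheme \<Rightarrow> 'g topology \<Rightarrow> 'g measure \<Rightarrow> bool" where
  "haar_measure G X \<mu> \<longleftrightarrow>
     space \<mu> = carrier G \<and> sets \<mu> = sigma_sets (carrier G) {U. openin X U} \<and>
     emeasure \<mu> (carrier G) \<noteq> 0 \<and>
     (\<forall>g\<in>carrier G. \<forall>A\<in>sets \<mu>. emeasure \<mu> (g <#\<^bsub>G\<^esub> A) = emeasure \<mu> A) \<and>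
     (\<forall>K. compactin X K \<longrightarrow> emeasure \<mu> K < \<infinity>) \<and>
     (\<forall>A\<in>sets \<mu>. emeasure \<mu> A = (INF U\<in>{U. openin X U \<and> A \<subseteq> U}. emeasure \<mu> U)) \<and>
     (\<forall>U. openin X U \<longrightarrow> emeasure \<mu> U = (SUP K\<in>{K. compactin X K \<and> K \<subseteq> U}. emeasure \<mu> K))"

text \<open>Values of a test function outside the carrier are irrelevant.\<close>

definition test_functions :: "'g topology \<Rightarrow> ('g \<Rightarrow> complex) set" where
  "test_functions X =
     {f. (\<forall>x\<in>topspace X. \<exists>U. openin X U \<and> x \<in> U \<and> (\<forall>y\<in>U. f y = f x)) \<and>
         compactin X (X closure_of {x \<in> topspace X. f x \<noteq> 0})}"

section \<open>Representations\<close>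

text \<open>Representations on topological vector spaces whose underlying set need not be a whole type,
  so that quotients \<open>F / E\<close> are included. The underlying set is the topological space of
  \<open>rtop\<close>.\<close>

record ('g, 'a) top_rep =
  rtop :: "'a topology"
  rzero :: 'a
  radd :: "'a \<Rightarrow> 'a \<Rightarrow> 'a"
  rscale :: "complex \<Rightarrow> 'a \<Rightarrow> 'a"
  ract :: "'g \<Rightarrow> 'a \<Rightarrow> 'a"

abbreviation rspace :: "('g, 'a) top_rep \<Rightarrow> 'a set" where
  "rspace S \<equiv> topspace (rtop S)"

definition complex_tvs :: "('g, 'a) top_rep \<Rightarrow> bool" where
  "complex_tvs S \<longleftrightarrow>
     rzero S \<in> rspace S \<and>
     (\<forall>x\<in>rspace S. \<forall>y\<in>rspace S. radd S x y \<in> rspace S \<and> radd S x y = radd S y x) \<and>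
     (\<forall>x\<in>rspace S. \<forall>y\<in>rspace S. \<forall>z\<in>rspace S.
        radd S (radd S x y) z = radd S x (radd S y z)) \<and>
     (\<forall>x\<in>rspace S. radd S (rzero S) x = x \<and> (\<exists>y\<in>rspace S. radd S x y = rzero S)) \<and>
     (\<forall>c. \<forall>x\<in>rspace S. rscale S c x \<in> rspace S) \<and>
     (\<forall>c. \<forall>x\<in>rspace S. \<forall>y\<in>rspace S.
        rscale S c (radd S x y) = radd S (rscale S c x) (rscale S c y)) \<and>
     (\<forall>c d. \<forall>x\<in>rspace S.
        rscale S (c + d) x = radd S (rscale S c x) (rscale S d x) \<and>
        rscale S (c * d) x = rscale S c (rscale S d x)) \<and>
     (\<forall>x\<in>rspace S. rscale S 1 x = x) \<and>
     continuous_map (prod_topology (rtop S) (rtop S)) (rtop S) (\<lambda>(x, y). radd S x y) \<and>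
     continuous_map (prod_topology euclidean (rtop S)) (rtop S) (\<lambda>(c, x). rscale S c x)"

definition continuous_rep ::
  "('g, 'm) monoid_scheme \<Rightarrow> 'g topology \<Rightarrow> ('g, 'a) top_rep \<Rightarrow> bool" where
  "continuous_rep G X S \<longleftrightarrow>
     complex_tvs S \<and>
     (\<forall>g\<in>carrier G. \<forall>x\<in>rspace S. ract S g x \<in> rspace S) \<and>
     (\<forall>g\<in>carrier G. \<forall>x\<in>rspace S. \<forall>y\<in>rspace S.
        ract S g (radd S x y) = radd S (ract S g x) (ract S g y)) \<and>
     (\<forall>g\<in>carrier G. \<forall>c. \<forall>x\<in>rspace S. ract S g (rscale S c x) = rscale S c (ract S g x)) \<and>
     (\<forall>x\<in>rspace S. ract S \<one>\<^bsub>G\<^esub> x = x) \<and>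
     (\<forall>g\<in>carrier G. \<forall>h\<in>carrier G. \<forall>x\<in>rspace S.
        ract S (g \<otimes>\<^bsub>G\<^esub> h) x = ract S g (ract S h x)) \<and>
     continuous_map (prod_topology X (rtop S)) (rtop S) (\<lambda>(g, x). ract S g x)"

definition closed_invariant_subspace ::
  "('g, 'm) monoid_scheme \<Rightarrow> ('g, 'a) top_rep \<Rightarrow> 'a set \<Rightarrow> bool" where
  "closed_invariant_subspace G S U \<longleftrightarrow>
     closedin (rtop S) U \<and> rzero S \<in> U \<and>
     (\<forall>x\<in>U. \<forall>y\<in>U. radd S x y \<in> U) \<and>
     (\<forall>c. \<forall>x\<in>U. rscale S c x \<in> U) \<and>
     (\<forall>g\<in>carrier G. \<forall>x\<in>U. ract S g x \<in> U)"

definition irreducible_rep :: "('g, 'm) monoid_scheme \<Rightarrow> ('g, 'a) top_rep \<Rightarrow> bool" where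
  "irreducible_rep G S \<longleftrightarrow>
     rspace S \<noteq> {rzero S} \<and>
     (\<forall>U. closed_invariant_subspace G S U \<longrightarrow> U = {rzero S} \<or> U = rspace S)"

definition isomorphic_rep ::
  "('g, 'm) monoid_scheme \<Rightarrow> ('g, 'a) top_rep \<Rightarrow> ('g, 'b) top_rep \<Rightarrow> bool" where
  "isomorphic_rep G S T \<longleftrightarrow>
     (\<exists>\<phi>. homeomorphic_map (rtop S) (rtop T) \<phi> \<and>
          (\<forall>x\<in>rspace S. \<forall>y\<in>rspace S. \<phi> (radd S x y) = radd T (\<phi> x) (\<phi> y)) \<and>
          (\<forall>c. \<forall>x\<in>rspace S. \<phi> (rscale S c x) = rscale T c (\<phi> x)) \<and>
          (\<forall>g\<in>carrier G. \<forall>x\<in>rspace S. \<phi> (ract S g x) = ract T g (\<phi> x)))"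

section \<open>Compact Hilbert representations, subrepresentations and subquotients\<close>

definition hilbert_rep :: "('g \<Rightarrow> 'v::complex_hilbert \<Rightarrow> 'v) \<Rightarrow> ('g, 'v) top_rep" where
  "hilbert_rep R =
     \<lparr>rtop = euclidean, rzero = 0, radd = (+), rscale = scaleC, ract = R\<rparr>"

text \<open>The library's Bochner integral requires second countable spaces, while \<open>'v\<close> may be
  nonseparable; \<open>R(f)v\<close> is therefore the weak integral of \<open>f(g) R(g)v\<close>.\<close>

definition rep_operator ::
  "'g measure \<Rightarrow> ('g \<Rightarrow> 'v::complex_hilbert \<Rightarrow> 'v) \<Rightarrow> ('g \<Rightarrow> complex) \<Rightarrow> 'v \<Rightarrow> 'v" where
  "rep_operator \<mu> R f v =
     (THE u. \<forall>w. cinner u w = (\<integral>g. f g * cinner (R g v) w \<partial>\<mu>))"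

definition compact_operator :: "('v::complex_hilbert \<Rightarrow> 'v) \<Rightarrow> bool" where
  "compact_operator T \<longleftrightarrow>
     (\<forall>x y. T (x + y) = T x + T y) \<and> (\<forall>c x. T (c *\<^sub>C x) = c *\<^sub>C T x) \<and>
     compact (closure (T ` cball 0 1))"

definition compact_hilbert_rep ::
  "('g, 'm) monoid_scheme \<Rightarrow> 'g topology \<Rightarrow> 'g measure \<Rightarrow>
     ('g \<Rightarrow> 'v::complex_hilbert \<Rightarrow> 'v) \<Rightarrow> bool" where
  "compact_hilbert_rep G X \<mu> R \<longleftrightarrow>
     continuous_rep G X (hilbert_rep R) \<and>
     (\<forall>f\<in>test_functions X. compact_operator (rep_operator \<mu> R f))"

abbreviation subrep ::
  "('g, 'm) monoid_scheme \<Rightarrow> ('g \<Rightarrow> 'v::complex_hilbert \<Rightarrow> 'v) \<Rightarrow> 'v set \<Rightarrow> bool" where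
  "subrep G R E \<equiv> closed_invariant_subspace G (hilbert_rep R) E"

definition add_coset :: "'v::ab_group_add set \<Rightarrow> 'v \<Rightarrow> 'v set" where
  "add_coset E v = (\<lambda>e. v + e) ` E"

text \<open>The quotient \<open>F / E\<close>, consisting of the cosets of \<open>E\<close> in \<open>F\<close>, with the quotient topology.
  In \<open>rscale\<close> the summand from \<open>E\<close> is needed only for the scalar \<open>0\<close>.\<close>

definition quotient_rep ::
  "('g \<Rightarrow> 'v::complex_hilbert \<Rightarrow> 'v) \<Rightarrow> 'v set \<Rightarrow> 'v set \<Rightarrow> ('g, 'v set) top_rep" where
  "quotient_rep R F E =
     \<lparr>rtop = topology (\<lambda>W. W \<subseteq> add_coset E ` F \<and>
                            openin (top_of_set F) {v \<in> F. add_coset E v \<in> W}),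
      rzero = E,
      radd = (\<lambda>A B. {a + b | a b. a \<in> A \<and> b \<in> B}),
      rscale = (\<lambda>c A. {c *\<^sub>C a + e | a e. a \<in> A \<and> e \<in> E}),
      ract = (\<lambda>g A. R g ` A)\<rparr>"

lemma quotient_map_quotient_rep:
  "quotient_map (top_of_set F) (rtop (quotient_rep R F E)) (add_coset E)"
proof -
  let ?P = "\<lambda>W. W \<subseteq> add_coset E ` F \<and> openin (top_of_set F) {v \<in> F. add_coset E v \<in> W}"
  have "istopology ?P"
    unfolding istopology_def
  proof (intro conjI allI impI)
    fix S T assume S: "?P S" and T: "?P T"
    have "{v \<in> F. add_coset E v \<in> S \<inter> T} =
        {v \<in> F. add_coset E v \<in> S} \<inter> {v \<in> F. add_coset E v \<in> T}" by auto
    then show "openin (top_of_set F) {v \<in> F. add_coset E v \<in> S \<inter> T}"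
      using S T by (simp add: openin_Int)
    show "S \<inter> T \<subseteq> add_coset E ` F" using S by auto
  next
    fix \<K> assume K: "\<forall>K\<in>\<K>. ?P K"
    have "{v \<in> F. add_coset E v \<in> \<Union>\<K>} = (\<Union>K\<in>\<K>. {v \<in> F. add_coset E v \<in> K})" by auto
    moreover have "openin (top_of_set F) (\<Union>K\<in>\<K>. {v \<in> F. add_coset E v \<in> K})"
      using K by (intro openin_Union) auto
    ultimately show "openin (top_of_set F) {v \<in> F. add_coset E v \<in> \<Union>\<K>}" by metis
    show "\<Union>\<K> \<subseteq> add_coset E ` F" using K by auto
  qed
  then have op: "openin (rtop (quotient_rep R F E)) = ?P"
    by (simp add: quotient_rep_def topology_inverse')
  have "?P (add_coset E ` F)"
  proof -
    have "{v \<in> F. add_coset E v \<in> add_coset E ` F} = F" by auto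
    then show ?thesis by simp
  qed
  then have "rspace (quotient_rep R F E) = add_coset E ` F"
    unfolding topspace_def op by blast
  then show ?thesis
    by (simp add: quotient_map_def op)
qed

section \<open>Ladders and complete filtrations\<close>

text \<open>A linearly ordered set is a set \<open>L\<close> with a reflexive order relation \<open>r\<close> on it.\<close>

definition less_in :: "'i rel \<Rightarrow> 'i \<Rightarrow> 'i \<Rightarrow> bool" where
  "less_in r a b \<longleftrightarrow> (a, b) \<in> r \<and> a \<noteq> b"

definition neighbours :: "'i set \<Rightarrow> 'i rel \<Rightarrow> 'i \<Rightarrow> 'i \<Rightarrow> bool" where
  "neighbours L r a b \<longleftrightarrow>
     a \<in> L \<and> b \<in> L \<and> less_in r a b \<and> \<not> (\<exists>c\<in>L. less_in r a c \<and> less_in r c b)"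

definition having_neighbour :: "'i set \<Rightarrow> 'i rel \<Rightarrow> 'i set" where
  "having_neighbour L r = {a \<in> L. \<exists>b. neighbours L r a b \<or> neighbours L r b a}"

definition is_sup_in :: "'i set \<Rightarrow> 'i rel \<Rightarrow> 'i set \<Rightarrow> 'i \<Rightarrow> bool" where
  "is_sup_in L r S a \<longleftrightarrow>
     a \<in> L \<and> (\<forall>s\<in>S. (s, a) \<in> r) \<and> (\<forall>u\<in>L. (\<forall>s\<in>S. (s, u) \<in> r) \<longrightarrow> (a, u) \<in> r)"

definition is_inf_in :: "'i set \<Rightarrow> 'i rel \<Rightarrow> 'i set \<Rightarrow> 'i \<Rightarrow> bool" where
  "is_inf_in L r S a \<longleftrightarrow>
     a \<in> L \<and> (\<forall>s\<in>S. (a, s) \<in> r) \<and> (\<forall>u\<in>L. (\<forall>s\<in>S. (u, s) \<in> r) \<longrightarrow> (u, a) \<in> r)"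

definition ladder :: "'i set \<Rightarrow> 'i rel \<Rightarrow> bool" where
  "ladder L r \<longleftrightarrow>
     linear_order_on L r \<and>
     (\<forall>a \<in> L - having_neighbour L r.
        is_sup_in L r {b \<in> having_neighbour L r. less_in r b a} a \<and>
        is_inf_in L r {c \<in> having_neighbour L r. less_in r a c} a)"

text \<open>In the last clause, cuts \<open>(A, B)\<close> between two neighbours \<open>a < b\<close> are excluded: there the two
  sides are \<open>F a\<close> and \<open>F b\<close>, which must differ. One of \<open>A\<close> and \<open>B\<close> may be empty; the empty union
  of subspaces is the zero space (hence \<open>insert 0\<close>), the empty intersection is the whole space.
  So \<open>0\<close> and the whole space are the ends of the filtration.\<close>

definition complete_filtration ::
  "('g, 'm) monoid_scheme \<Rightarrow> ('g \<Rightarrow> 'v::complex_hilbert \<Rightarrow> 'v) \<Rightarrow>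
     'i set \<Rightarrow> 'i rel \<Rightarrow> ('i \<Rightarrow> 'v set) \<Rightarrow> bool" where
  "complete_filtration G R L r F \<longleftrightarrow>
     ladder L r \<and>
     (\<forall>a\<in>L. subrep G R (F a)) \<and>
     (\<forall>a\<in>L. \<forall>b\<in>L. less_in r a b \<longrightarrow> F a \<subset> F b) \<and>
     (\<forall>a b. neighbours L r a b \<longrightarrow> irreducible_rep G (quotient_rep R (F b) (F a))) \<and>
     (\<forall>A B. A \<union> B = L \<longrightarrow> A \<inter> B = {} \<longrightarrow> (\<forall>a\<in>A. \<forall>b\<in>B. less_in r a b) \<longrightarrow>
        \<not> (\<exists>a\<in>A. \<exists>b\<in>B. neighbours L r a b) \<longrightarrow>
        closure (insert 0 (\<Union>a\<in>A. F a)) = (\<Inter>b\<in>B. F b))"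

section \<open>Multiplicities\<close>

definition multiplicity_of ::
  "('g, 'm) monoid_scheme \<Rightarrow> ('g \<Rightarrow> 'v::complex_hilbert \<Rightarrow> 'v) \<Rightarrow> ('g, 'w) top_rep \<Rightarrow> enat" where
  "multiplicity_of G R \<pi> =
     Sup {enat k | k. \<exists>F :: nat \<Rightarrow> 'v set.
       (\<forall>i\<in>{1..2 * k}. subrep G R (F i)) \<and>
       (\<forall>i\<in>{1..2 * k}. \<forall>j\<in>{1..2 * k}. i \<le> j \<longrightarrow> F i \<subseteq> F j) \<and>
       (\<forall>j\<in>{1..k}. isomorphic_rep G (quotient_rep R (F (2 * j)) (F (2 * j - 1))) \<pi>)}"

end

(*
  For a compact open subgroup K, R applied to the normalised indicator function of K averages over K:
  it is a projection onto the K-fixed vectors V^K which preserves every subrepresentation. As it is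
  compact, V^K has compact unit ball, and by van Dantzig's theorem every vector is approximated by
  its averages. Hence distinct subrepresentations E < F are separated by some V^K, and a chain of
  subrepresentations between them must jump at the place where its trace on V^K first leaves E.
  A maximal chain of subrepresentations is therefore a ladder, and it is a complete filtration whose
  jumps are the irreducible subquotients. If pi occurs in R then it has a nonzero K-fixed vector for
  some K, so each occurrence of pi in a filtration contributes a new unit vector to V^K, orthogonal
  to the previous ones; compactness bounds their number.
*)
theory Submission
  imports Defs
begin

section \<open>Complex Hilbert spaces\<close>

text \<open>The representation is not assumed unitary: orthogonal complements of subrepresentations
  need not be invariant, so \<open>R\<close> cannot be split, and averages need not be orthogonal
  projections. Apart from duality, orthogonality only serves to pick unit vectors inside the spaces
  V^K, where the real inner product suffices because every complex subspace is a real one. Since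
  \<open>rep_operator\<close> is a weak integral, an average is known only through its inner
  products; membership in a closed subspace is read off by testing against the vectors orthogonal to
  it. The compact unit ball of V^K replaces dimension counts: along a decreasing chain, unit vectors
  orthogonal to the lower trace survive by the finite intersection property, and orthonormal
  families are compared with a finite net. Indexing the filtration by the chain itself makes the
  limit condition nearly automatic, as a maximal chain contains the closed unions and the
  intersections of its subfamilies.\<close>

lemma closed_subspace_orthogonal_decomp:
  fixes S :: "'a::{real_inner, complete_space} set"
  assumes "subspace S" "closed S"
  shows "\<exists>p\<in>S. \<forall>y\<in>S. inner (x - p) y = 0"
proof -
  define D where "D = (INF y\<in>S. (norm (x - y))\<^sup>2)"
  have bdd: "bdd_below ((\<lambda>y. (norm (x - y))\<^sup>2) ` S)"
    by (rule bdd_belowI[of _ 0]) auto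
  have ne: "S \<noteq> {}" using assms(1) subspace_0 by blast
  have D_le: "D \<le> (norm (x - y))\<^sup>2" if "y \<in> S" for y
    unfolding D_def using bdd that by (rule cINF_lower)
  have "\<exists>y\<in>S. (norm (x - y))\<^sup>2 < D + e" if "e > 0" for e
  proof -
    have "D < D + e" using that by simp
    then show ?thesis unfolding D_def using cINF_less_iff[OF ne bdd] by blast
  qed
  then have "\<forall>n. \<exists>y\<in>S. (norm (x - y))\<^sup>2 < D + inverse (Suc n)" by simp
  then obtain s where s: "\<And>n. s n \<in> S" "\<And>n. (norm (x - s n))\<^sup>2 < D + inverse (Suc n)"
    by metis
  \<comment> \<open>Parallelogram identity: the midpoint of \<open>s m\<close> and
    \<open>s n\<close> lies in \<open>S\<close>, so its squared distance to \<open>x\<close> is at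
    least \<open>D\<close>.\<close>
  have par: "(norm (s m - s n))\<^sup>2 \<le> 2 * inverse (Suc m) + 2 * inverse (Suc n)" for m n
  proof -
    have "(1/2) *\<^sub>R (s m + s n) \<in> S"
      using assms(1) s(1) by (intro subspace_scale subspace_add)
    then have "4 * D \<le> 4 * (norm (x - (1/2) *\<^sub>R (s m + s n)))\<^sup>2" using D_le by simp
    also have "\<dots> = (norm (2 *\<^sub>R (x - (1/2) *\<^sub>R (s m + s n))))\<^sup>2"
      by (simp add: power_mult_distrib)
    also have "2 *\<^sub>R (x - (1/2) *\<^sub>R (s m + s n)) = (x - s m) + (x - s n)"
      by (simp add: algebra_simps scaleR_2)
    finally have "4 * D \<le> (norm ((x - s m) + (x - s n)))\<^sup>2" .
    moreover have "s m - s n = (x - s n) - (x - s m)" by simp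
    then have "(norm (s m - s n))\<^sup>2 = 2 * (norm (x - s m))\<^sup>2 + 2 * (norm (x - s n))\<^sup>2
        - (norm ((x - s m) + (x - s n)))\<^sup>2"
      by (simp only: power2_norm_eq_inner) (simp add: algebra_simps inner_commute)
    ultimately show ?thesis using s(2)[of m] s(2)[of n] by linarith
  qed
  have "Cauchy s"
  proof (rule metric_CauchyI)
    fix e :: real assume "e > 0"
    then obtain N where N: "inverse (Suc N) < e\<^sup>2 / 4"
      using reals_Archimedean[of "e\<^sup>2 / 4"] by auto
    have "dist (s m) (s n) < e" if "m \<ge> N" "n \<ge> N" for m n
    proof -
      have "inverse (real (Suc m)) \<le> inverse (Suc N)" "inverse (real (Suc n)) \<le> inverse (Suc N)"
        using that by (auto simp: divide_simps)
      then have "(norm (s m - s n))\<^sup>2 < e\<^sup>2" using par[of m n] N by linarith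
      then show ?thesis using \<open>e > 0\<close> by (simp add: dist_norm power2_less_imp_less)
    qed
    then show "\<exists>M. \<forall>m\<ge>M. \<forall>n\<ge>M. dist (s m) (s n) < e" by blast
  qed
  then obtain p where p: "s \<longlonglongrightarrow> p" using Cauchy_convergent convergent_def by blast
  have pS: "p \<in> S" using closed_sequentially[OF assms(2)] s(1) p by blast
  have "(\<lambda>n. (norm (x - s n))\<^sup>2) \<longlonglongrightarrow> (norm (x - p))\<^sup>2" using p by (intro tendsto_intros)
  moreover have "(\<lambda>n. D + inverse (real (Suc n))) \<longlonglongrightarrow> D + 0"
    by (intro tendsto_intros LIMSEQ_inverse_real_of_nat)
  ultimately have pD: "(norm (x - p))\<^sup>2 \<le> D"
    using s(2) by (intro LIMSEQ_le[of _ _ _ D]) (auto intro: less_imp_le)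
  have "inner (x - p) y = 0" if "y \<in> S" for y
  proof (cases "y = 0")
    case False
    \<comment> \<open>\<open>t *\<^sub>R y\<close> is the point of the line through \<open>y\<close>
      closest to \<open>x - p\<close>. No point of \<open>S\<close> is closer to \<open>x\<close>
      than \<open>p\<close>, so the gain \<open>(inner (x - p) y)\<^sup>2 / (norm y)\<^sup>2\<close>
      must vanish.\<close>
    define t where "t = inner (x - p) y / (norm y)\<^sup>2"
    have "p + t *\<^sub>R y \<in> S" using assms(1) pS that by (intro subspace_add subspace_scale)
    then have "(norm (x - p))\<^sup>2 \<le> (norm ((x - p) - t *\<^sub>R y))\<^sup>2"
      using pD D_le by (metis diff_diff_eq order_trans)
    also have "\<dots> = (norm (x - p))\<^sup>2 - 2 * t * inner (x - p) y + t\<^sup>2 * (norm y)\<^sup>2"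
      unfolding power2_norm_eq_inner
      by (simp add: inner_diff_left inner_diff_right inner_commute power2_eq_square algebra_simps)
    also have "\<dots> = (norm (x - p))\<^sup>2 - (inner (x - p) y)\<^sup>2 / (norm y)\<^sup>2"
      using False by (simp add: t_def field_simps power2_eq_square)
    finally have "(inner (x - p) y)\<^sup>2 / (norm y)\<^sup>2 \<le> 0" by simp
    then show ?thesis using False by (simp add: divide_le_0_iff)
  qed simp
  then show ?thesis using pS by blast
qed

text \<open>The residual \<open>x - p\<close> of the projection is itself orthogonal to
  \<open>S\<close>, so it may be used as a test vector. This gives membership for vectors known only
  weakly, such as averages.\<close>

lemma closed_subspace_orthogonal_memI:
  fixes S :: "'a::{real_inner, complete_space} set"
  assumes "subspace S" "closed S" "\<And>w. (\<And>y. y \<in> S \<Longrightarrow> inner y w = 0) \<Longrightarrow> inner x w = 0"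
  shows "x \<in> S"
proof -
  obtain p where p: "p \<in> S" "\<And>y. y \<in> S \<Longrightarrow> inner (x - p) y = 0"
    using closed_subspace_orthogonal_decomp[OF assms(1,2)] by blast
  then have "inner x (x - p) = 0" "inner p (x - p) = 0"
    using assms(3)[of "x - p"] by (auto simp: inner_commute)
  then have "inner (x - p) (x - p) = 0" by (simp add: inner_diff_left)
  then show ?thesis using p(1) by simp
qed

text \<open>The vector is the normalised residual \<open>x - p\<close>. A strict inclusion of
  subspaces thus yields a unit vector, which compactness arguments can hold on to.\<close>

lemma orthogonal_unit_vector:
  fixes S T :: "'a::{real_inner, complete_space} set"
  assumes "subspace S" "closed S" "subspace T" "S \<subseteq> T" "x \<in> T" "x \<notin> S"
  shows "\<exists>e\<in>T. norm e = 1 \<and> (\<forall>y\<in>S. inner e y = 0)"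
proof -
  obtain p where p: "p \<in> S" "\<And>y. y \<in> S \<Longrightarrow> inner (x - p) y = 0"
    using closed_subspace_orthogonal_decomp[OF assms(1,2)] by blast
  have "x - p \<noteq> 0" using p(1) assms(6) by auto
  moreover have "x - p \<in> T" using assms p by (auto intro: subspace_diff)
  ultimately show ?thesis
    using p assms(3) by (intro bexI[of _ "inverse (norm (x - p)) *\<^sub>R (x - p)"]) (auto intro: subspace_scale)
qed

lemma Riesz_representation_real:
  fixes f :: "'a::{real_inner, complete_space} \<Rightarrow> real"
  assumes "linear f" "continuous_on UNIV f"
  shows "\<exists>w. \<forall>x. f x = inner x w"
proof (cases "\<forall>x. f x = 0")
  case True
  then show ?thesis by (intro exI[of _ 0]) auto
next
  case False
  then obtain x0 where x0: "f x0 \<noteq> 0" by blast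
  interpret linear f by fact
  have "closed (f -` {0})" using assms(2) by (simp add: continuous_on_closed_vimage)
  moreover have sub: "subspace (f -` {0})" by (auto simp: subspace_def add scale zero)
  ultimately obtain p where p: "f p = 0" "\<And>y. f y = 0 \<Longrightarrow> inner (x0 - p) y = 0"
    using closed_subspace_orthogonal_decomp[of "f -` {0}" x0] by auto
  define z where "z = x0 - p"
  have fz: "f z \<noteq> 0" using x0 p(1) by (simp add: z_def diff)
  then have z0: "z \<noteq> 0" using zero by auto
  \<comment> \<open>Subtracting a suitable multiple of \<open>z\<close> from \<open>x\<close> leaves
    a vector of the kernel, and the kernel is orthogonal to \<open>z\<close>.\<close>
  have "f x = inner x ((f z / (norm z)\<^sup>2) *\<^sub>R z)" for x
  proof -
    have "f (x - (f x / f z) *\<^sub>R z) = 0" using fz by (simp add: diff scale)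
    then have "inner z (x - (f x / f z) *\<^sub>R z) = 0" using p(2) by (simp add: z_def)
    then have "inner x z = (f x / f z) * (norm z)\<^sup>2"
      by (simp add: inner_diff_right inner_commute power2_norm_eq_inner)
    then show ?thesis using fz z0 by simp
  qed
  then show ?thesis by blast
qed

section \<open>The complex inner product and complex Riesz representation\<close>

lemma cinner_add_right: "cinner x (y + z) = cinner x y + cinner x z"
  using arg_cong[OF cinner_add_left[of y z x], of cnj] by (simp flip: cinner_commute)

lemma cinner_scaleC_right: "cinner x (c *\<^sub>C y) = cnj c * cinner x y"
  using arg_cong[OF cinner_scaleC_left[of c y x], of cnj] by (simp flip: cinner_commute)

lemma cinner_diff_left: "cinner (x - y) z = cinner x z - cinner y z"
  using cinner_add_left[of "x - y" y z] by (simp add: algebra_simps)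

lemma Im_cinner: "Im (cinner x y) = - inner (\<i> *\<^sub>C x) y"
  by (simp add: inner_eq_Re_cinner cinner_scaleC_left)

lemma scaleC_diff_right: "c *\<^sub>C (x - y) = c *\<^sub>C x - c *\<^sub>C y"
  using scaleC_add_right[of c "x - y" y] by (simp add: algebra_simps)

lemma scaleC_zero_right: "c *\<^sub>C 0 = 0"
  using scaleC_diff_right[of c 0 0] by simp

lemma cinner_self: "cinner x x = complex_of_real ((norm x)\<^sup>2)"
proof -
  have "Im (cinner x x) = 0" using arg_cong[OF cinner_commute[of x x], of Im] by simp
  moreover have "Re (cinner x x) = (norm x)\<^sup>2"
    using inner_eq_Re_cinner[of x x] power2_norm_eq_inner[of x] by simp
  ultimately show ?thesis by (simp add: complex_eq_iff)
qed

lemma norm_scaleC: "norm (c *\<^sub>C x) = cmod c * norm x"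
proof -
  have "complex_of_real ((norm (c *\<^sub>C x))\<^sup>2) = c * cnj c * cinner x x"
    by (simp only: cinner_self[symmetric] cinner_scaleC_left cinner_scaleC_right ac_simps)
  also have "\<dots> = complex_of_real ((cmod c * norm x)\<^sup>2)"
    using complex_norm_square[of c] by (simp add: cinner_self power_mult_distrib)
  finally have "(norm (c *\<^sub>C x))\<^sup>2 = (cmod c * norm x)\<^sup>2" by (simp only: of_real_eq_iff)
  then show ?thesis by (simp add: power2_eq_iff_nonneg)
qed

lemma norm_cinner_le: "cmod (cinner x y) \<le> norm x * norm y"
proof (cases "cinner x y = 0")
  case False
  \<comment> \<open>A unimodular factor rotating \<open>cinner x y\<close> onto the positive reals,
    where the real Cauchy-Schwarz inequality applies.\<close>
  define c where "c = cnj (cinner x y) / cmod (cinner x y)"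
  have c: "cmod c = 1" using False by (simp add: c_def norm_divide)
  have "cinner (c *\<^sub>C x) y = cmod (cinner x y)"
    using False by (simp add: cinner_scaleC_left c_def complex_norm_square[symmetric] mult.commute power2_eq_square)
  then have "cmod (cinner x y) = inner (c *\<^sub>C x) y" by (simp add: inner_eq_Re_cinner)
  also have "\<dots> \<le> norm (c *\<^sub>C x) * norm y" by (rule norm_cauchy_schwarz)
  finally show ?thesis using c by (simp add: norm_scaleC)
qed simp

lemma cinner_eqI:
  assumes "\<And>w. cinner x w = cinner y w"
  shows "x = (y::'a::complex_hilbert)"
proof -
  have "cinner (x - y) (x - y) = 0" using assms by (simp add: cinner_diff_left)
  then show ?thesis by (simp add: cinner_self)
qed

lemma bounded_linear_cinner_left: "bounded_linear (\<lambda>x. cinner x (w::'a::complex_hilbert))"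
proof (rule bounded_linear_intro[where K = "norm w"])
  show "cinner (r *\<^sub>R x) w = r *\<^sub>R cinner x w" for r x
    by (simp add: scaleR_scaleC cinner_scaleC_left scaleR_conv_of_real)
qed (auto simp: cinner_add_left norm_cinner_le)

lemma Riesz_representation_complex:
  fixes f :: "'a::complex_hilbert \<Rightarrow> complex"
  assumes "\<And>x y. f (x + y) = f x + f y" "\<And>c x. f (c *\<^sub>C x) = c * f x" "continuous_on UNIV f"
  shows "\<exists>w. \<forall>x. f x = cinner x w"
proof -
  have "linear (\<lambda>x. Re (f x))"
    by (rule linearI) (simp_all add: assms scaleR_scaleC)
  moreover have "continuous_on UNIV (\<lambda>x. Re (f x))" using assms(3) by (intro continuous_intros)
  ultimately obtain w where w: "\<And>x. Re (f x) = inner x w"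
    using Riesz_representation_real by blast
  \<comment> \<open>Evaluation at \<open>\<i> *\<^sub>C x\<close> exchanges real and imaginary parts
    up to sign, so the real representation determines the complex one.\<close>
  have "Im (f x) = Im (cinner x w)" for x
    using w[of "\<i> *\<^sub>C x"] by (simp add: assms(2) Im_cinner)
  then show ?thesis using w by (auto simp: complex_eq_iff inner_eq_Re_cinner)
qed

section \<open>Totally disconnected groups\<close>

locale tdlc_group =
  fixes G :: "('g, 'm) monoid_scheme" (structure) and X :: "'g topology"
  assumes topological_group: "topological_group G X"
    and totally_disconnected: "totally_disconnected_space X"
    and locally_compact: "locally_compact_space X"
begin

sublocale group G
  using topological_group by (simp add: topological_group_def)

lemma topspace_eq [simp]: "topspace X = carrier G"
  using topological_group by (simp add: topological_group_def)

lemma continuous_mult: "continuous_map (prod_topology X X) X (\<lambda>(x, y). x \<otimes> y)"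
  and continuous_inv: "continuous_map X X (\<lambda>x. inv x)"
  using topological_group by (simp_all add: topological_group_def)

lemma continuous_left_mult:
  assumes "g \<in> carrier G"
  shows "continuous_map X X (\<lambda>x. g \<otimes> x)"
proof -
  have "continuous_map X (prod_topology X X) (\<lambda>x. (g, x))"
    using assms by (simp add: continuous_map_paired)
  from continuous_map_compose[OF this continuous_mult] show ?thesis by (simp add: o_def)
qed

lemma l_coset_eq_vimage:
  assumes "g \<in> carrier G" "A \<subseteq> carrier G"
  shows "g <# A = {x \<in> carrier G. inv g \<otimes> x \<in> A}"
proof safe
  fix x assume "x \<in> g <# A"
  then obtain a where "a \<in> A" "x = g \<otimes> a" by (auto simp: l_coset_def)
  then show "x \<in> carrier G" "inv g \<otimes> x \<in> A"
    using assms by (auto simp: m_assoc[symmetric] subsetD)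
next
  fix x assume "x \<in> carrier G" "inv g \<otimes> x \<in> A"
  then show "x \<in> g <# A" using assms
    by (auto simp: l_coset_def m_assoc[symmetric] intro!: bexI[of _ "inv g \<otimes> x"])
qed

lemma openin_l_coset:
  assumes "g \<in> carrier G" "openin X U"
  shows "openin X (g <# U)"
  using openin_continuous_map_preimage[OF continuous_left_mult[OF inv_closed[OF assms(1)]] assms(2)]
    l_coset_eq_vimage[OF assms(1)] openin_subset[OF assms(2)] by simp

text \<open>The closure of \<open>{\<one>}\<close> is connected, hence a single point; the diagonal
  is then the preimage of a closed point under the map taking \<open>(x, y)\<close> to
  \<open>x \<otimes> inv y\<close>.\<close>

lemma Hausdorff_space: "Hausdorff_space X"
proof -
  have "connectedin X (X closure_of {\<one>})" by (intro connectedin_closure_of) simp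
  then obtain y where "X closure_of {\<one>} \<subseteq> {y}"
    using totally_disconnected unfolding totally_disconnected_space_def by blast
  moreover have "\<one> \<in> X closure_of {\<one>}"
    using closure_of_subset[of "{\<one>}" X] by simp
  ultimately have "X closure_of {\<one>} = {\<one>}" by blast
  then have cl: "closedin X {\<one>}" using closedin_closure_of[of X "{\<one>}"] by simp
  have "continuous_map (prod_topology X X) (prod_topology X X) (\<lambda>(x, y). (x, inv y))"
    using continuous_map_compose[OF continuous_map_snd continuous_inv]
    by (auto simp: continuous_map_paired case_prod_unfold o_def continuous_map_fst)
  from continuous_map_compose[OF this continuous_mult]
  have "continuous_map (prod_topology X X) X (\<lambda>(x, y). x \<otimes> inv y)"
    by (simp add: o_def case_prod_unfold)
  from closedin_continuous_map_preimage[OF this cl]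
  have "closedin (prod_topology X X) {p \<in> carrier G \<times> carrier G. fst p \<otimes> inv (snd p) = \<one>}"
    by (simp add: case_prod_unfold)
  also have "{p \<in> carrier G \<times> carrier G. fst p \<otimes> inv (snd p) = \<one>} = (\<lambda>x. (x, x)) ` topspace X"
  proof -
    have eq: "x = y" if "x \<in> carrier G" "y \<in> carrier G" "x \<otimes> inv y = \<one>" for x y
      using inv_equality[OF that(3)] that(1,2) by simp
    show ?thesis by (auto simp: image_iff intro: eq[symmetric])
  qed
  finally show ?thesis by (simp add: Hausdorff_space_closedin_diagonal)
qed

text \<open>The complement is a union of left cosets, each of them open.\<close>

lemma closedin_open_subgroup:
  assumes "subgroup H G" "openin X H"
  shows "closedin X H"
proof -
  interpret H: subgroup H G by fact
  have "openin X (\<Union>g\<in>carrier G - H. g <# H)"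
    using openin_l_coset[OF _ assms(2)] by blast
  also have "(\<Union>g\<in>carrier G - H. g <# H) = carrier G - H"
  proof
    show "(\<Union>g\<in>carrier G - H. g <# H) \<subseteq> carrier G - H"
    proof safe
      fix g x assume g: "g \<in> carrier G" "g \<notin> H" "x \<in> g <# H"
      then obtain h where h: "h \<in> H" "x = g \<otimes> h" by (auto simp: l_coset_def)
      then show "x \<in> carrier G" using g by auto
      assume "x \<in> H"
      then have "x \<otimes> inv h \<in> H" using h by blast
      then show False using g h by (simp add: m_assoc)
    qed
    show "carrier G - H \<subseteq> (\<Union>g\<in>carrier G - H. g <# H)"
    proof
      fix x assume x: "x \<in> carrier G - H"
      then have "x \<otimes> \<one> \<in> x <# H" unfolding l_coset_def using H.one_closed by blast
      then show "x \<in> (\<Union>g\<in>carrier G - H. g <# H)" using x by auto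
    qed
  qed
  finally show ?thesis by (simp add: closedin_def H.subset)
qed

text \<open>Van Dantzig's theorem. A compact open set \<open>C\<close> around the identity is
  stabilised from the right by a whole neighbourhood of the identity; the elements that stabilise it
  together with their inverses form the subgroup.\<close>

theorem compact_open_subgroup_exists:
  assumes U: "openin X U" "\<one> \<in> U"
  obtains K where "subgroup K G" "openin X K" "compactin X K" "K \<subseteq> U"
proof -
  obtain D N where DN: "openin X N" "compactin X D" "\<one> \<in> N" "N \<subseteq> D"
    using locally_compact[unfolded locally_compact_space_def, rule_format, of \<one>] by auto
  have "connected_component_of_set X \<one> = {\<one>}"
  proof -
    obtain y where "connected_component_of_set X \<one> \<subseteq> {y}"
      using totally_disconnected connectedin_connected_component_of[of X \<one>]
      unfolding totally_disconnected_space_def by blast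
    moreover have "\<one> \<in> connected_component_of_set X \<one>"
      by (simp add: connected_component_of_refl)
    ultimately show ?thesis by blast
  qed
  then have "{\<one>} \<in> connected_components_of X"
    unfolding connected_components_of_def by force
  \<comment> \<open>A compact component of a locally compact Hausdorff space has arbitrarily small
    clopen neighbourhoods. Lying in \<open>N\<close> makes \<open>C\<close> compact, lying in
    \<open>U\<close> makes it small.\<close>
  then obtain C C' where C: "openin X C" "openin X C'" "disjnt C C'" "C \<union> C' = topspace X"
    "{\<one>} \<subseteq> C" "C \<subseteq> N \<inter> U"
    using wilder_locally_compact_component_thm[OF locally_compact Hausdorff_space, of "{\<one>}" "N \<inter> U"]
      U DN by (auto intro: openin_Int)
  have "C = topspace X - C'" using C by (auto simp: disjnt_def)
  then have "closedin X C" using C(2) by blast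
  then have Ccomp: "compactin X C" using DN C(6) closed_compactin by (metis le_inf_iff subset_trans)
  have Csub: "C \<subseteq> carrier G" using openin_subset[OF C(1)] by simp
  define W where "W = {p \<in> topspace (prod_topology X X). (case p of (x, y) \<Rightarrow> x \<otimes> y) \<in> C}"
  have "openin (prod_topology X X) W"
    unfolding W_def using continuous_mult C(1) by (rule openin_continuous_map_preimage)
  moreover have "C \<times> {\<one>} \<subseteq> W" using Csub by (auto simp: W_def)
  \<comment> \<open>Tube lemma along the compact \<open>C\<close>: a single neighbourhood
    \<open>V\<close> of the identity has \<open>x \<otimes> g \<in> C\<close> for all
    \<open>x\<close> in \<open>C\<close> and \<open>g\<close> in \<open>V\<close>.\<close>
  ultimately obtain U' V where V: "openin X V" "C \<subseteq> U'" "\<one> \<in> V" "U' \<times> V \<subseteq> W"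
    using tube_lemma_left[OF _ Ccomp, of X W \<one>] by auto
  define S where "S = {g \<in> carrier G. \<forall>x\<in>C. x \<otimes> g \<in> C}"
  have VS: "V \<subseteq> S" using V openin_subset[OF V(1)] by (force simp: S_def W_def)
  define K where "K = {g \<in> carrier G. g \<in> S \<and> inv g \<in> S}"
  define V' where "V' = V \<inter> {g \<in> topspace X. inv g \<in> V}"
  have V': "openin X V'" "\<one> \<in> V'" "V' \<subseteq> K"
    using V VS openin_subset[OF V(1)]
      openin_Int[OF V(1) openin_continuous_map_preimage[OF continuous_inv V(1)]]
    by (auto simp: V'_def K_def)
  have Smult: "g \<otimes> h \<in> S" if "g \<in> S" "h \<in> S" for g h
    using that Csub by (auto simp: S_def m_assoc[symmetric] subsetD)
  have K: "subgroup K G"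
  proof (rule subgroupI)
    show "K \<subseteq> carrier G" "K \<noteq> {}" using V' by (auto simp: K_def)
    show "inv a \<in> K" if "a \<in> K" for a using that by (auto simp: K_def)
    show "a \<otimes> b \<in> K" if "a \<in> K" "b \<in> K" for a b
      using that Smult by (auto simp: K_def inv_mult_group)
  qed
  interpret K: subgroup K G by fact
  \<comment> \<open>Containing a neighbourhood of the identity, the subgroup \<open>K\<close>
    contains a translate of it around each of its points.\<close>
  have "k <# V' \<subseteq> K" "k \<in> k <# V'" if "k \<in> K" for k
  proof -
    show "k <# V' \<subseteq> K" using that V'(3) by (auto simp: l_coset_def)
    have "k \<otimes> \<one> \<in> k <# V'" unfolding l_coset_def using V'(2) by blast
    then show "k \<in> k <# V'" using that K.subset by auto
  qed
  then have "K = \<Union>((\<lambda>k. k <# V') ` K)" by blast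
  moreover have "openin X (\<Union>((\<lambda>k. k <# V') ` K))"
    using openin_l_coset[OF _ V'(1)] K.subset by (intro openin_Union) auto
  ultimately have "openin X K" by simp
  \<comment> \<open>Since \<open>\<one>\<close> lies in \<open>C\<close>, an element
    \<open>k\<close> stabilising \<open>C\<close> from the right satisfies
    \<open>\<one> \<otimes> k \<in> C\<close>.\<close>
  moreover have "K \<subseteq> C"
  proof
    fix k assume "k \<in> K"
    then have "k \<in> carrier G" "\<forall>x\<in>C. x \<otimes> k \<in> C" unfolding K_def S_def by blast+
    then show "k \<in> C" using C(5) l_one by (metis insert_subset)
  qed
  moreover from this have "compactin X K"
    using closed_compactin[OF Ccomp] closedin_open_subgroup[OF K \<open>openin X K\<close>] by simp
  ultimately show ?thesis using that[OF K] C(6) subset_trans[of K C U] by simp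
qed

end

section \<open>Haar measure: invariance and positivity on open sets\<close>

locale tdlc_group_haar = tdlc_group G X for G :: "('g, 'm) monoid_scheme" (structure) and X +
  fixes \<mu> :: "'g measure"
  assumes haar: "haar_measure G X \<mu>"
begin

lemma space_haar [simp]: "space \<mu> = carrier G"
  and sets_haar: "sets \<mu> = sigma_sets (carrier G) {U. openin X U}"
  and emeasure_l_coset: "g \<in> carrier G \<Longrightarrow> A \<in> sets \<mu> \<Longrightarrow> emeasure \<mu> (g <# A) = emeasure \<mu> A"
  and emeasure_compact: "compactin X K \<Longrightarrow> emeasure \<mu> K < \<infinity>"
  using haar by (simp_all add: haar_measure_def)

lemma openin_sets_haar: "openin X U \<Longrightarrow> U \<in> sets \<mu>"
  by (simp add: sets_haar sigma_sets.Basic)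

lemma borel_measurable_continuous_map:
  fixes f :: "'g \<Rightarrow> 'b::topological_space"
  assumes "continuous_map X euclidean f"
  shows "f \<in> borel_measurable \<mu>"
proof (rule borel_measurableI)
  fix S :: "'b set" assume "open S"
  then have "openin X {x \<in> topspace X. f x \<in> S}"
    using assms by (intro openin_continuous_map_preimage) auto
  moreover have "f -` S \<inter> space \<mu> = {x \<in> topspace X. f x \<in> S}" by auto
  ultimately show "f -` S \<inter> space \<mu> \<in> sets \<mu>" by (simp add: openin_sets_haar)
qed

lemma measurable_left_mult:
  assumes "g \<in> carrier G"
  shows "(\<lambda>x. g \<otimes> x) \<in> measurable \<mu> \<mu>"
proof (rule measurable_sigma_sets[OF sets_haar])
  fix U assume "U \<in> {U. openin X U}"
  then have "openin X {x \<in> topspace X. g \<otimes> x \<in> U}"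
    using continuous_left_mult[OF assms] by (intro openin_continuous_map_preimage) auto
  moreover have "(\<lambda>x. g \<otimes> x) -` U \<inter> space \<mu> = {x \<in> topspace X. g \<otimes> x \<in> U}" by auto
  ultimately show "(\<lambda>x. g \<otimes> x) -` U \<inter> space \<mu> \<in> sets \<mu>" by (simp add: openin_sets_haar)
qed (use assms in \<open>auto dest!: openin_subset\<close>)

lemma integral_left_mult:
  fixes f :: "'g \<Rightarrow> complex"
  assumes g: "g \<in> carrier G" and f: "f \<in> borel_measurable \<mu>"
  shows "(\<integral>x. f (g \<otimes> x) \<partial>\<mu>) = (\<integral>x. f x \<partial>\<mu>)"
proof -
  \<comment> \<open>Left invariance as an identity of push-forward measures: the preimage of
    \<open>A\<close> is its translate by \<open>inv g\<close>.\<close>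
  have "distr \<mu> \<mu> (\<lambda>x. g \<otimes> x) = \<mu>"
  proof (rule measure_eqI)
    fix A assume "A \<in> sets (distr \<mu> \<mu> (\<lambda>x. g \<otimes> x))"
    then have A: "A \<in> sets \<mu>" by simp
    then have "A \<subseteq> carrier G" using sets.sets_into_space by force
    then have "(\<lambda>x. g \<otimes> x) -` A \<inter> space \<mu> = inv g <# A"
      using g by (auto simp: l_coset_eq_vimage)
    then show "emeasure (distr \<mu> \<mu> (\<lambda>x. g \<otimes> x)) A = emeasure \<mu> A"
      using emeasure_distr[OF measurable_left_mult[OF g] A] emeasure_l_coset[OF _ A] g by simp
  qed simp
  then show ?thesis using integral_distr[OF measurable_left_mult[OF g] f] by simp
qed

text \<open>Finitely many translates of \<open>U\<close> cover any compact set. If \<open>U\<close>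
  were null, all compact sets would be null, and by inner regularity of the open set
  \<open>carrier G\<close> so would be the whole group.\<close>

lemma emeasure_open_pos:
  assumes U: "openin X U" "U \<noteq> {}"
  shows "emeasure \<mu> U \<noteq> 0"
proof
  assume 0: "emeasure \<mu> U = 0"
  obtain u where u: "u \<in> U" using U by blast
  have uc: "u \<in> carrier G" and Uc: "U \<subseteq> carrier G" using u openin_subset[OF U(1)] by auto
  have "emeasure \<mu> K = 0" if K: "compactin X K" for K
  proof -
    have Kc: "K \<subseteq> carrier G" using compactin_subset_topspace[OF K] by simp
    have "K \<subseteq> \<Union>((\<lambda>g. g <# U) ` carrier G)"
    proof
      fix x assume "x \<in> K"
      then have "x \<in> carrier G" using Kc by blast
      then have "x \<otimes> inv u \<otimes> u = x" "x \<otimes> inv u \<in> carrier G" using uc by (simp_all add: m_assoc)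
      then show "x \<in> \<Union>((\<lambda>g. g <# U) ` carrier G)" using u by (force simp: l_coset_def)
    qed
    then obtain F where F: "finite F" "F \<subseteq> (\<lambda>g. g <# U) ` carrier G" "K \<subseteq> \<Union>F"
      using compactinD[OF K, of "(\<lambda>g. g <# U) ` carrier G"] openin_l_coset[OF _ U(1)] by blast
    have "A \<in> null_sets \<mu>" if "A \<in> F" for A
      using that F(2) 0 U(1) by (auto simp: null_sets_def emeasure_l_coset openin_sets_haar openin_l_coset)
    then have "\<Union>F \<in> null_sets \<mu>" using F(1) null_sets.finite_Union[of F] by blast
    then show ?thesis
      using F(3) by (metis emeasure_mono le_zero_eq null_setsD1 null_setsD2)
  qed
  then have "(SUP K\<in>{K. compactin X K \<and> K \<subseteq> carrier G}. emeasure \<mu> K) = 0"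
    by (intro SUP_eq_const) auto
  moreover have "openin X (carrier G)" using openin_topspace[of X] by simp
  ultimately have "emeasure \<mu> (carrier G) = 0"
    using haar unfolding haar_measure_def by force
  then show False using haar by (simp add: haar_measure_def)
qed

end

section \<open>Averaging over compact open subgroups\<close>

text \<open>Relative compactness bounds the image of the unit ball, and homogeneity extends the
  bound to all vectors.\<close>

lemma compact_operator_bounded_linear:
  assumes "compact_operator T"
  shows "bounded_linear T"
proof -
  have add: "T (x + y) = T x + T y" and scaleC: "T (c *\<^sub>C x) = c *\<^sub>C T x" for x y c
    using assms by (auto simp: compact_operator_def)
  have scale: "T (r *\<^sub>R x) = r *\<^sub>R T x" for r x by (simp add: scaleR_scaleC scaleC)
  have "bounded (T ` cball 0 1)"
    using assms unfolding compact_operator_def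
    by (meson bounded_subset closure_subset compact_imp_bounded)
  then obtain B where "\<forall>y\<in>T ` cball 0 1. norm y \<le> B"
    unfolding bounded_iff by blast
  then have B: "norm (T x) \<le> B" if "norm x \<le> 1" for x using that by auto
  have "norm (T x) \<le> norm x * B" for x
  proof (cases "x = 0")
    case True
    then show ?thesis using scale[of 0 x] by simp
  next
    case False
    then have "norm (T (inverse (norm x) *\<^sub>R x)) \<le> B" by (intro B) simp
    then show ?thesis using False by (simp add: scale field_simps)
  qed
  then show ?thesis using add scale by (intro bounded_linear_intro)
qed

locale compact_rep = tdlc_group_haar G X \<mu>
  for G :: "('g, 'm) monoid_scheme" (structure) and X and \<mu> +
  fixes R :: "'g \<Rightarrow> 'v::complex_hilbert \<Rightarrow> 'v"
  assumes rep: "compact_hilbert_rep G X \<mu> R"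
begin

lemma R_add: "g \<in> carrier G \<Longrightarrow> R g (x + y) = R g x + R g y"
  and R_scaleC: "g \<in> carrier G \<Longrightarrow> R g (c *\<^sub>C x) = c *\<^sub>C R g x"
  and R_one: "R \<one> x = x"
  and R_mult: "g \<in> carrier G \<Longrightarrow> h \<in> carrier G \<Longrightarrow> R (g \<otimes> h) x = R g (R h x)"
  and R_continuous: "continuous_map (prod_topology X euclidean) euclidean (\<lambda>(g, x). R g x)"
  using rep by (simp_all add: compact_hilbert_rep_def continuous_rep_def hilbert_rep_def)

lemma R_inv: "g \<in> carrier G \<Longrightarrow> R (inv g) (R g x) = x" "g \<in> carrier G \<Longrightarrow> R g (R (inv g) x) = x"
  by (simp_all flip: R_mult add: R_one)

lemma R_linear: "g \<in> carrier G \<Longrightarrow> linear (R g)"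
  by (rule linearI) (simp_all add: R_add scaleR_scaleC R_scaleC)

lemma R_orbit_continuous: "continuous_map X euclidean (\<lambda>g. R g v)"
proof -
  have "continuous_map X (prod_topology X euclidean) (\<lambda>g. (g, v))"
    by (simp add: continuous_map_paired)
  from continuous_map_compose[OF this R_continuous] show ?thesis by (simp add: o_def)
qed

lemma R_continuous_on: "g \<in> carrier G \<Longrightarrow> continuous_on S (R g)"
proof -
  assume "g \<in> carrier G"
  then have "continuous_map euclidean (prod_topology X euclidean) (\<lambda>x::'v. (g, x))"
    by (simp add: continuous_map_paired)
  from continuous_map_compose[OF this R_continuous] have "continuous_on UNIV (R g)"
    by (simp add: o_def)
  then show ?thesis using continuous_on_subset by blast
qed

text \<open>As \<open>R g\<close> need not be unitary, it does not cross the inner product as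
  \<open>R (inv g)\<close>; Riesz representation supplies some adjoint vector instead. It lets
  \<open>R h\<close> be pulled into the weak integral.\<close>

lemma R_adjoint:
  assumes "g \<in> carrier G"
  shows "\<exists>w'. \<forall>x. cinner (R g x) w = cinner x w'"
proof (rule Riesz_representation_complex)
  show "continuous_on UNIV (\<lambda>x. cinner (R g x) w)"
    by (intro bounded_linear.continuous_on[OF bounded_linear_cinner_left] R_continuous_on assms)
qed (simp_all add: assms R_add R_scaleC cinner_add_left cinner_scaleC_left)

section \<open>Weights, averages and fixed vectors of a compact open subgroup\<close>

definition compact_open_subgroup :: "'g set \<Rightarrow> bool" where
  "compact_open_subgroup K \<longleftrightarrow> subgroup K G \<and> openin X K \<and> compactin X K"

text \<open>Real valued, so that it can serve in real integrals for estimates; coerced to the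
  complex numbers it is the test function behind \<open>average\<close>.\<close>

definition weight :: "'g set \<Rightarrow> 'g \<Rightarrow> real" where
  "weight K g = indicator K g / measure \<mu> K"

definition average :: "'g set \<Rightarrow> 'v \<Rightarrow> 'v" where
  "average K = rep_operator \<mu> R (\<lambda>g. complex_of_real (weight K g))"

definition fixed_vectors :: "'g set \<Rightarrow> 'v set" where
  "fixed_vectors K = {v. \<forall>g\<in>K. R g v = v}"

context
  fixes K assumes K: "compact_open_subgroup K"
begin

lemma K_subgroup: "subgroup K G" using K by (simp add: compact_open_subgroup_def)

lemmas K_subset = subgroup.subset[OF K_subgroup]

lemma K_open: "openin X K" and K_compact: "compactin X K" and K_sets: "K \<in> sets \<mu>"
  using K openin_sets_haar by (auto simp: compact_open_subgroup_def)

lemma K_nonempty: "K \<noteq> {}" using subgroup.one_closed[OF K_subgroup] by blast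

text \<open>\<open>measure\<close> is \<open>0\<close> also on sets of infinite measure, so
  positivity needs finiteness, from compactness, as well as nonvanishing, from openness.\<close>

lemma measure_K_pos: "measure \<mu> K > 0"
  using emeasure_compact[OF K_compact] emeasure_open_pos[OF K_open K_nonempty]
  by (auto simp: measure_def enn2real_positive_iff zero_less_iff_neq_zero)

lemma weight_simps: "g \<in> K \<Longrightarrow> weight K g = 1 / measure \<mu> K" "g \<notin> K \<Longrightarrow> weight K g = 0"
  by (simp_all add: weight_def)

lemma weight_nonneg: "weight K g \<ge> 0"
  using measure_K_pos by (simp add: weight_def)

lemma weight_measurable: "weight K \<in> borel_measurable \<mu>"
  unfolding weight_def[abs_def] using K_sets by measurable

lemma weight_integral: "integral\<^sup>L \<mu> (weight K) = 1"
  unfolding weight_def[abs_def]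
  using measure_K_pos sets.sets_into_space[OF K_sets] by (simp add: Int_absorb2)

text \<open>An open subgroup is also closed, so the weight is locally constant off \<open>K\<close>
  too, and its support is the compact set \<open>K\<close>.\<close>

lemma weight_test_function: "(\<lambda>g. complex_of_real (weight K g)) \<in> test_functions X"
proof -
  have cl: "closedin X K" using closedin_open_subgroup K K_open by (simp add: compact_open_subgroup_def)
  have "{x \<in> topspace X. complex_of_real (weight K x) \<noteq> 0} = K"
    using measure_K_pos K_subset by (auto simp: weight_def indicator_def)
  then have "compactin X (X closure_of {x \<in> topspace X. complex_of_real (weight K x) \<noteq> 0})"
    using cl K_compact by (simp add: closure_of_closedin)
  moreover have "\<exists>U. openin X U \<and> x \<in> U \<and> (\<forall>y\<in>U. complex_of_real (weight K y) = complex_of_real (weight K x))"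
    if "x \<in> topspace X" for x
  proof (cases "x \<in> K")
    case True
    then show ?thesis using K_open by (intro exI[of _ K]) (simp add: weight_simps)
  next
    case False
    then show ?thesis using cl that
      by (intro exI[of _ "topspace X - K"]) (auto simp: weight_simps closedin_def)
  qed
  ultimately show ?thesis by (simp add: test_functions_def)
qed

lemma continuous_map_bounded_on_K:
  fixes h :: "'g \<Rightarrow> 'b::real_normed_vector"
  assumes "continuous_map X euclidean h"
  shows "\<exists>B. \<forall>g\<in>K. norm (h g) \<le> B"
proof -
  have "compact (h ` K)" using image_compactin[OF K_compact assms] by simp
  then have "bounded (h ` K)" by (rule compact_imp_bounded)
  then show ?thesis by (simp add: bounded_iff)
qed

lemma weight_integrable:
  fixes h :: "'g \<Rightarrow> 'b::{banach, second_countable_topology}"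
  assumes h: "continuous_map X euclidean h"
  shows "integrable \<mu> (\<lambda>g. weight K g *\<^sub>R h g)"
proof -
  obtain B where B: "\<And>g. g \<in> K \<Longrightarrow> norm (h g) \<le> B"
    using continuous_map_bounded_on_K[OF h] by blast
  show ?thesis
  proof (rule integrableI_bounded_set[OF K_sets])
    show "(\<lambda>g. weight K g *\<^sub>R h g) \<in> borel_measurable \<mu>"
      using weight_measurable borel_measurable_continuous_map[OF h] by measurable
    show "AE g in \<mu>. g \<in> K \<longrightarrow> norm (weight K g *\<^sub>R h g) \<le> B / measure \<mu> K"
      using B measure_K_pos by (auto simp: weight_simps divide_right_mono)
  qed (use emeasure_compact[OF K_compact] in \<open>auto simp: weight_simps\<close>)
qed

lemma continuous_cinner_orbit: "continuous_map X euclidean (\<lambda>g. cinner (R g v) w)"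
proof -
  have "continuous_on UNIV (\<lambda>x. cinner x w)"
    using bounded_linear_cinner_left by (rule linear_continuous_on)
  then show ?thesis
    using continuous_map_compose[OF R_orbit_continuous, of euclidean "\<lambda>x. cinner x w" v]
    by (simp add: o_def)
qed

text \<open>\<open>rep_operator\<close> is a definite description, which says nothing until the weak
  integral is known to exist. The orbit of \<open>v\<close> is bounded over the compact
  \<open>K\<close>, so the integral is a bounded functional of \<open>w\<close> and Riesz
  representation yields the vector.\<close>

lemma cinner_average:
  "cinner (average K v) w = (\<integral>g. complex_of_real (weight K g) * cinner (R g v) w \<partial>\<mu>)"
proof -
  let ?I = "\<lambda>w. \<integral>g. complex_of_real (weight K g) * cinner (R g v) w \<partial>\<mu>"
  have int: "integrable \<mu> (\<lambda>g. complex_of_real (weight K g) * cinner (R g v) w)" for w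
    using weight_integrable[OF continuous_cinner_orbit] by (simp add: scaleR_conv_of_real)
  have add: "?I (x + y) = ?I x + ?I y" for x y
    using int by (simp add: cinner_add_right distrib_left)
  have scale: "?I (c *\<^sub>C x) = cnj c * ?I x" for c x
    by (simp add: cinner_scaleC_right mult.left_commute)
  obtain B where B: "\<And>g. g \<in> K \<Longrightarrow> norm (R g v) \<le> B"
    using continuous_map_bounded_on_K[OF R_orbit_continuous[of v]] by blast
  have bd: "norm (?I w) \<le> norm w * B" for w
  proof -
    have "norm (?I w) \<le> (\<integral>g. norm (complex_of_real (weight K g) * cinner (R g v) w) \<partial>\<mu>)"
      by (rule integral_norm_bound)
    also have "\<dots> \<le> (\<integral>g. weight K g *\<^sub>R (B * norm w) \<partial>\<mu>)"
    proof (rule integral_mono)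
      show "integrable \<mu> (\<lambda>g. norm (complex_of_real (weight K g) * cinner (R g v) w))"
        using int by (rule integrable_norm)
      show "integrable \<mu> (\<lambda>g. weight K g *\<^sub>R (B * norm w))"
        by (rule weight_integrable) simp
      fix g
      have "norm (cinner (R g v) w) \<le> B * norm w" if "g \<in> K"
        using norm_cinner_le[of "R g v" w] mult_right_mono[OF B[OF that], of "norm w"] by simp
      then show "norm (complex_of_real (weight K g) * cinner (R g v) w) \<le> weight K g *\<^sub>R (B * norm w)"
        using weight_nonneg[of g] weight_simps(2)[of g]
        by (cases "g \<in> K") (auto simp: norm_mult intro: mult_left_mono)
    qed
    also have "\<dots> = norm w * B" by (simp add: weight_integral)
    finally show ?thesis .
  qed
  \<comment> \<open>The integral is conjugate linear in \<open>w\<close>; conjugation makes it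
    linear.\<close>
  have "bounded_linear (\<lambda>w. cnj (?I w))"
  proof (rule bounded_linear_intro)
    show "cnj (?I (r *\<^sub>R x)) = r *\<^sub>R cnj (?I x)" for r x
      unfolding scaleR_scaleC by (simp add: scale scaleR_conv_of_real del: integral_mult_right_zero)
  qed (use add bd in auto)
  then have "\<exists>u. \<forall>w. cnj (?I w) = cinner w u"
    using add scale by (intro Riesz_representation_complex linear_continuous_on) auto
  then obtain u where "\<And>w. cnj (?I w) = cinner w u" by blast
  then have u: "\<forall>w. cinner u w = ?I w"
    by (metis cinner_commute complex_cnj_cnj)
  have "average K v = u"
    unfolding average_def rep_operator_def
    by (rule the_equality) (use u in \<open>auto intro: cinner_eqI\<close>)
  then show ?thesis using u by blast
qed

text \<open>The weight is nonnegative of total mass 1, so an upper bound on all values passes to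
  their average. Half-space bounds are the only access to the weak integral needed below: they give
  both membership in closed subspaces and norm estimates.\<close>

lemma inner_average_diff_le:
  assumes "\<And>g. g \<in> K \<Longrightarrow> inner (R g v - x) w \<le> c"
  shows "inner (average K v - x) w \<le> c"
proof -
  have int: "integrable \<mu> (\<lambda>g. complex_of_real (weight K g) * cinner (R g v) w)"
    using weight_integrable[OF continuous_cinner_orbit] by (simp add: scaleR_conv_of_real)
  have "inner (average K v) w = (\<integral>g. Re (complex_of_real (weight K g) * cinner (R g v) w) \<partial>\<mu>)"
    using integral_bounded_linear[OF bounded_linear_Re int]
    by (simp add: inner_eq_Re_cinner cinner_average)
  also have "\<dots> = (\<integral>g. weight K g *\<^sub>R inner (R g v) w \<partial>\<mu>)" by (simp add: inner_eq_Re_cinner)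
  also have "\<dots> \<le> (\<integral>g. weight K g *\<^sub>R (c + inner x w) \<partial>\<mu>)"
  proof (rule integral_mono)
    have "continuous_map X euclidean (\<lambda>g. inner (R g v) w)"
      using continuous_map_compose[OF R_orbit_continuous, of euclidean "\<lambda>x. inner x w" v]
      by (simp add: o_def continuous_on_inner continuous_on_const continuous_on_id)
    then show "integrable \<mu> (\<lambda>g. weight K g *\<^sub>R inner (R g v) w)" by (rule weight_integrable)
    show "integrable \<mu> (\<lambda>g. weight K g *\<^sub>R (c + inner x w))" by (rule weight_integrable) simp
    show "weight K g *\<^sub>R inner (R g v) w \<le> weight K g *\<^sub>R (c + inner x w)" for g
      using assms[of g] weight_nonneg[of g] weight_simps(2)[of g]
      by (cases "g \<in> K") (auto simp: inner_diff_left intro: mult_left_mono)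
  qed
  also have "\<dots> = c + inner x w" by (simp add: weight_integral)
  finally show ?thesis by (simp add: inner_diff_left)
qed

text \<open>The half-space bound for \<open>w\<close> and \<open>- w\<close>, with \<open>w\<close>
  orthogonal to \<open>E\<close>. The case \<open>x = 0\<close> yields invariance of
  subrepresentations, \<open>E = {0}\<close> that fixed vectors are their own averages, and
  \<open>x = v\<close> that averaging preserves a \<open>K\<close>-fixed coset.\<close>

lemma average_diff_in:
  assumes E: "subspace E" "closed E" and x: "\<And>g. g \<in> K \<Longrightarrow> R g v - x \<in> E"
  shows "average K v - x \<in> E"
proof (rule closed_subspace_orthogonal_memI[OF E])
  fix w assume w: "\<And>y. y \<in> E \<Longrightarrow> inner y w = 0"
  have "inner (average K v - x) w \<le> 0" "inner (average K v - x) (- w) \<le> 0"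
    using w x by (intro inner_average_diff_le; simp)+
  then show "inner (average K v - x) w = 0" by simp
qed

text \<open>Applying \<open>R h\<close> with \<open>h\<close> in \<open>K\<close> amounts to
  translating the integrand by \<open>h\<close>, which changes neither the weight nor, by left
  invariance, the integral.\<close>

lemma average_in_fixed: "average K v \<in> fixed_vectors K"
  unfolding fixed_vectors_def
proof safe
  fix h assume h: "h \<in> K"
  show "R h (average K v) = average K v"
  proof (rule cinner_eqI)
    fix w
    let ?f = "\<lambda>g. complex_of_real (weight K g) * cinner (R g v) w"
    obtain w' where w': "\<And>x. cinner (R h x) w = cinner x w'" using R_adjoint[of h w] h K_subset by blast
    have meas: "?f \<in> borel_measurable \<mu>"
      using weight_measurable borel_measurable_continuous_map[OF continuous_cinner_orbit] by measurable
    have "weight K (h \<otimes> g) = weight K g" if "g \<in> carrier G" for g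
    proof -
      have "h \<otimes> g \<in> K \<longleftrightarrow> g \<in> K"
        using h that subgroup.m_closed[OF K_subgroup] subgroup.m_inv_closed[OF K_subgroup h]
        by (metis subgroup.mem_carrier[OF K_subgroup] l_inv l_one m_assoc)
      then show ?thesis by (simp add: weight_def indicator_def)
    qed
    then have "(\<integral>g. ?f (h \<otimes> g) \<partial>\<mu>) = (\<integral>g. complex_of_real (weight K g) * cinner (R g v) w' \<partial>\<mu>)"
      using h K_subset by (intro Bochner_Integration.integral_cong) (auto simp: R_mult w' subset_iff)
    then show "cinner (R h (average K v)) w = cinner (average K v) w"
      using integral_left_mult[OF _ meas, of h] h K_subset by (simp add: w' cinner_average subset_iff)
  qed
qed

lemma average_fixed: "v \<in> fixed_vectors K \<Longrightarrow> average K v = v"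
  using average_diff_in[of "{0}" v v] by (auto simp: fixed_vectors_def subspace_def)

lemma compact_operator_average: "compact_operator (average K)"
  using rep weight_test_function by (simp add: compact_hilbert_rep_def average_def)

lemma bounded_linear_average: "bounded_linear (average K)"
  using compact_operator_average by (rule compact_operator_bounded_linear)

lemma subspace_fixed_vectors: "subspace (fixed_vectors K)"
  using linear_0[OF R_linear] linear_add[OF R_linear] linear_scale[OF R_linear] K_subset
  by (auto simp: subspace_def fixed_vectors_def subset_iff)

lemma closed_fixed_vectors: "closed (fixed_vectors K)"
proof -
  have "fixed_vectors K = (\<Inter>g\<in>K. {v. R g v = v})" by (auto simp: fixed_vectors_def)
  moreover have "closed {v. R g v = v}" if "g \<in> K" for g
    using that K_subset by (intro closed_Collect_eq R_continuous_on continuous_on_id) auto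
  ultimately show ?thesis by auto
qed

text \<open>Fixed vectors are their own averages, so those of norm at most 1 lie in the relatively
  compact image of the unit ball.\<close>

lemma compact_unit_ball_fixed_vectors: "compact (fixed_vectors K \<inter> cball 0 1)"
proof -
  have "fixed_vectors K \<inter> cball 0 1 \<subseteq> average K ` cball 0 1"
    using average_fixed by (force simp: image_iff)
  also have "\<dots> \<subseteq> closure (average K ` cball 0 1)" by (rule closure_subset)
  finally have "fixed_vectors K \<inter> cball 0 1 = (fixed_vectors K \<inter> cball 0 1) \<inter> closure (average K ` cball 0 1)"
    by blast
  moreover have "compact \<dots>"
    using compact_operator_average closed_fixed_vectors
    by (intro closed_Int_compact closed_Int closed_cball) (auto simp: compact_operator_def)
  ultimately show ?thesis by simp
qed

end

text \<open>By continuity \<open>R g v\<close> is within \<open>e\<close> of \<open>v\<close> for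
  \<open>g\<close> near the identity; van Dantzig's theorem puts a whole subgroup \<open>K\<close>
  there.\<close>

lemma average_approx:
  assumes e: "e > 0"
  obtains K where "compact_open_subgroup K" "norm (average K v - v) \<le> e"
proof -
  have "openin X {g \<in> topspace X. R g v \<in> ball v e}"
    using R_orbit_continuous by (rule openin_continuous_map_preimage) auto
  moreover have "\<one> \<in> {g \<in> topspace X. R g v \<in> ball v e}" using e by (simp add: R_one)
  ultimately obtain K where "subgroup K G" "openin X K" "compactin X K"
    and sub: "K \<subseteq> {g \<in> topspace X. R g v \<in> ball v e}"
    by (rule compact_open_subgroup_exists)
  then have K: "compact_open_subgroup K" by (simp add: compact_open_subgroup_def)
  let ?d = "average K v - v"
  \<comment> \<open>Testing the difference against itself turns the weak bound into a norm bound,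
    after cancelling \<open>norm ?d\<close>.\<close>
  have "inner ?d ?d \<le> e * norm ?d"
  proof (rule inner_average_diff_le[OF K])
    fix g assume "g \<in> K"
    then have "norm (R g v - v) \<le> e" using sub by (auto simp: dist_norm norm_minus_commute)
    then show "inner (R g v - v) ?d \<le> e * norm ?d"
      using norm_cauchy_schwarz[of "R g v - v" ?d] mult_right_mono[of _ e "norm ?d"]
      by (meson norm_ge_zero order_trans)
  qed
  then have "norm ?d * norm ?d \<le> e * norm ?d"
    by (simp add: power2_norm_eq_inner[symmetric] power2_eq_square)
  then have "norm ?d \<le> e"
    using e by (cases "norm ?d = 0") (auto simp: mult_le_cancel_right)
  then show ?thesis using K that by blast
qed

end

section \<open>Subrepresentations and quotients\<close>

lemma finite_chain_least:
  assumes "finite \<C>" "\<C> \<noteq> {}" "\<And>c d. c \<in> \<C> \<Longrightarrow> d \<in> \<C> \<Longrightarrow> c \<subseteq> d \<or> d \<subseteq> c"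
  shows "\<exists>c\<in>\<C>. \<forall>d\<in>\<C>. c \<subseteq> d"
proof -
  obtain c where "c \<in> \<C>" "\<forall>d\<in>\<C>. d \<subseteq> c \<longrightarrow> c = d"
    using finite_has_minimal[OF assms(1,2)] by auto
  then show ?thesis using assms(3) by (metis order_refl)
qed

lemma subrep_iff:
  "subrep G R E \<longleftrightarrow> closed E \<and> 0 \<in> E \<and> (\<forall>x\<in>E. \<forall>y\<in>E. x + y \<in> E) \<and>
     (\<forall>c. \<forall>x\<in>E. c *\<^sub>C x \<in> E) \<and> (\<forall>g\<in>carrier G. \<forall>x\<in>E. R g x \<in> E)"
  by (simp add: closed_invariant_subspace_def hilbert_rep_def)

lemma subrep_closed: "subrep G R E \<Longrightarrow> closed E"
  and subrep_zero: "subrep G R E \<Longrightarrow> 0 \<in> E"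
  and subrep_add: "subrep G R E \<Longrightarrow> x \<in> E \<Longrightarrow> y \<in> E \<Longrightarrow> x + y \<in> E"
  and subrep_scaleC: "subrep G R E \<Longrightarrow> x \<in> E \<Longrightarrow> c *\<^sub>C x \<in> E"
  and subrep_action: "subrep G R E \<Longrightarrow> g \<in> carrier G \<Longrightarrow> x \<in> E \<Longrightarrow> R g x \<in> E"
  by (simp_all add: subrep_iff)

lemma subspace_subrep: "subrep G R E \<Longrightarrow> subspace E"
  by (simp add: subspace_def subrep_iff scaleR_scaleC)

lemma subrep_Inter: "(\<And>E. E \<in> \<C> \<Longrightarrow> subrep G R E) \<Longrightarrow> subrep G R (\<Inter>\<C>)"
  unfolding subrep_iff by (auto intro: closed_Inter)

lemma bounded_linear_scaleC: "bounded_linear (\<lambda>x::'a::complex_hilbert. c *\<^sub>C x)"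
  by (rule bounded_linear_intro[where K = "cmod c"])
    (simp_all add: scaleC_add_right scaleR_scaleC scaleC_scaleC mult.commute norm_scaleC)

lemma add_coset_eq_iff:
  assumes "subspace E"
  shows "add_coset E v = add_coset E w \<longleftrightarrow> v - w \<in> E"
proof
  assume "add_coset E v = add_coset E w"
  moreover have "v \<in> add_coset E v"
    using subspace_0[OF assms] by (auto simp: add_coset_def image_iff intro!: bexI[of _ 0])
  ultimately show "v - w \<in> E" by (auto simp: add_coset_def)
next
  assume d: "v - w \<in> E"
  show "add_coset E v = add_coset E w"
  proof (intro equalityI subsetI)
    fix x assume "x \<in> add_coset E v"
    then obtain e where "e \<in> E" "x = v + e" by (auto simp: add_coset_def)
    then have "x = w + ((v - w) + e)" "(v - w) + e \<in> E" using d assms by (auto intro: subspace_add)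
    then show "x \<in> add_coset E w" unfolding add_coset_def by blast
  next
    fix x assume "x \<in> add_coset E w"
    then obtain e where "e \<in> E" "x = w + e" by (auto simp: add_coset_def)
    then have "x = v + (e - (v - w))" "e - (v - w) \<in> E" using d assms by (auto intro: subspace_diff)
    then show "x \<in> add_coset E v" unfolding add_coset_def by blast
  qed
qed

lemma add_coset_zero: "add_coset E 0 = E"
  by (simp add: add_coset_def)

context compact_rep
begin

text \<open>Comparability puts any two vectors of the union into one member, so the union is closed
  under sums; continuity carries the operations to the closure. \<open>insert 0\<close> covers the
  empty family.\<close>

lemma subrep_closure_Union:
  assumes sub: "\<And>E. E \<in> \<C> \<Longrightarrow> subrep G R E"
    and chain: "\<And>E F. E \<in> \<C> \<Longrightarrow> F \<in> \<C> \<Longrightarrow> E \<subseteq> F \<or> F \<subseteq> E"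
  shows "subrep G R (closure (insert 0 (\<Union>\<C>)))"
proof -
  let ?U = "insert 0 (\<Union>\<C>)"
  have add: "x + y \<in> ?U" if xy: "x \<in> ?U" "y \<in> ?U" for x y
  proof (cases "x = 0 \<or> y = 0")
    case True
    then show ?thesis using xy by (elim disjE) simp_all
  next
    case False
    then obtain E F where "E \<in> \<C>" "F \<in> \<C>" "x \<in> E" "y \<in> F" using xy by blast
    moreover from this have "E \<subseteq> F \<or> F \<subseteq> E" using chain by blast
    ultimately have "\<exists>E\<in>\<C>. x \<in> E \<and> y \<in> E" by blast
    then show ?thesis using subrep_add[OF sub] by blast
  qed
  have invariant: "f ` closure ?U \<subseteq> closure ?U" if "continuous_on UNIV f" "f ` ?U \<subseteq> ?U" for f
    using continuous_on_subset[OF that(1)] order_trans[OF that(2) closure_subset]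
    by (intro image_closure_subset closed_closure) auto
  have "x + y \<in> closure ?U" if xy: "x \<in> closure ?U" "y \<in> closure ?U" for x y
  proof -
    obtain a b where ab: "\<And>n. a n \<in> ?U" "\<And>n. b n \<in> ?U" and lim: "a \<longlonglongrightarrow> x" "b \<longlonglongrightarrow> y"
      using xy unfolding closure_sequential by metis
    have "\<forall>n. a n + b n \<in> ?U" using add[OF ab] by (rule allI)
    moreover have "(\<lambda>n. a n + b n) \<longlonglongrightarrow> x + y" using lim by (rule tendsto_add)
    ultimately show "x + y \<in> closure ?U" unfolding closure_sequential by (intro exI conjI)
  qed
  moreover have "c *\<^sub>C x \<in> closure ?U" if "x \<in> closure ?U" for c x
  proof -
    have "(\<lambda>x. c *\<^sub>C x) ` ?U \<subseteq> ?U"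
      using subrep_scaleC[OF sub] by (auto simp: scaleC_zero_right)
    then show ?thesis
      using invariant[OF linear_continuous_on[OF bounded_linear_scaleC]] that by blast
  qed
  moreover have "R g x \<in> closure ?U" if "g \<in> carrier G" "x \<in> closure ?U" for g x
  proof -
    have "R g ` ?U \<subseteq> ?U"
      using subrep_action[OF sub] that(1) linear_0[OF R_linear] by auto
    then show ?thesis
      using invariant[OF R_continuous_on[OF that(1)]] that(2) by blast
  qed
  moreover have "0 \<in> closure ?U" using closure_subset[of ?U] by blast
  ultimately show ?thesis unfolding subrep_iff by simp
qed

lemma average_in_subrep:
  assumes "compact_open_subgroup K" "subrep G R E" "v \<in> E"
  shows "average K v \<in> E"
  using average_diff_in[OF assms(1) subspace_subrep[OF assms(2)] subrep_closed[OF assms(2)], of v 0]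
    subrep_action[OF assms(2)] assms K_subset by auto

lemma exists_fixed_vector_outside:
  assumes E: "subrep G R E" and F: "subrep G R F" and sub: "E \<subset> F"
  obtains K x where "compact_open_subgroup K" "x \<in> F" "x \<in> fixed_vectors K" "x \<notin> E"
proof -
  obtain v where v: "v \<in> F" "v \<notin> E" using sub by blast
  obtain e where e: "e > 0" "ball v e \<inter> E = {}"
    using subrep_closed[OF E] v(2) by (metis Compl_iff disjoint_eq_subset_Compl openE open_Compl)
  \<comment> \<open>Halving \<open>e\<close> makes the estimate strict, as the open ball
    requires.\<close>
  then obtain K where K: "compact_open_subgroup K" "norm (average K v - v) \<le> e / 2"
    using average_approx[of "e / 2" v] by (metis half_gt_zero)
  have "average K v \<in> ball v e" using K(2) e(1) by (simp add: dist_norm norm_minus_commute)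
  then have "average K v \<notin> E" using e(2) by blast
  then show ?thesis
    using that[OF K(1)] average_in_subrep[OF K(1) F v(1)] average_in_fixed[OF K(1)] by blast
qed

section \<open>Arithmetic of cosets and irreducibility of quotients\<close>

lemma rspace_quotient: "rspace (quotient_rep R F E) = add_coset E ` F"
  using quotient_imp_surjective_map[OF quotient_map_quotient_rep[of F R E]] by simp

lemma quotient_zero: "rzero (quotient_rep R F E) = E"
  by (simp add: quotient_rep_def)

context
  fixes E assumes E: "subrep G R E"
begin

lemmas add_coset_eq_iff_subrep = add_coset_eq_iff[OF subspace_subrep[OF E]]

lemma quotient_add:
  "radd (quotient_rep R F E) (add_coset E v) (add_coset E w) = add_coset E (v + w)"
proof -
  have "{a + b |a b. a \<in> add_coset E v \<and> b \<in> add_coset E w} = add_coset E (v + w)"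
  proof safe
    fix a b assume "a \<in> add_coset E v" "b \<in> add_coset E w"
    then obtain d e where "d \<in> E" "e \<in> E" "a = v + d" "b = w + e" by (auto simp: add_coset_def)
    then have "a + b = v + w + (d + e)" "d + e \<in> E" using subrep_add[OF E] by auto
    then show "a + b \<in> add_coset E (v + w)" unfolding add_coset_def by blast
  next
    fix x assume "x \<in> add_coset E (v + w)"
    then obtain e where "e \<in> E" "x = (v + 0) + (w + e)" by (auto simp: add_coset_def add.assoc)
    then show "\<exists>a b. x = a + b \<and> a \<in> add_coset E v \<and> b \<in> add_coset E w"
      using subrep_zero[OF E] unfolding add_coset_def by blast
  qed
  then show ?thesis by (simp add: quotient_rep_def)
qed

lemma quotient_scale:
  "rscale (quotient_rep R F E) c (add_coset E v) = add_coset E (c *\<^sub>C v)"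
proof -
  have "{c *\<^sub>C a + e |a e. a \<in> add_coset E v \<and> e \<in> E} = add_coset E (c *\<^sub>C v)"
  proof safe
    fix a e assume "a \<in> add_coset E v" "e \<in> E"
    then obtain d where "d \<in> E" "a = v + d" by (auto simp: add_coset_def)
    then have "c *\<^sub>C a + e = c *\<^sub>C v + (c *\<^sub>C d + e)" "c *\<^sub>C d + e \<in> E"
      using subrep_add[OF E subrep_scaleC[OF E]] \<open>e \<in> E\<close> by (auto simp: scaleC_add_right)
    then show "c *\<^sub>C a + e \<in> add_coset E (c *\<^sub>C v)" unfolding add_coset_def by blast
  next
    fix x assume "x \<in> add_coset E (c *\<^sub>C v)"
    then obtain e where "e \<in> E" "x = c *\<^sub>C (v + 0) + e" by (auto simp: add_coset_def)
    then show "\<exists>a e. x = c *\<^sub>C a + e \<and> a \<in> add_coset E v \<and> e \<in> E"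
      using subrep_zero[OF E] unfolding add_coset_def by blast
  qed
  then show ?thesis by (simp add: quotient_rep_def)
qed

lemma quotient_action:
  assumes g: "g \<in> carrier G"
  shows "ract (quotient_rep R F E) g (add_coset E v) = add_coset E (R g v)"
proof -
  have "R g ` add_coset E v = add_coset E (R g v)"
  proof safe
    fix x assume "x \<in> add_coset E v"
    then show "R g x \<in> add_coset E (R g v)"
      using subrep_action[OF E g] by (auto simp: add_coset_def R_add[OF g])
  next
    fix x assume "x \<in> add_coset E (R g v)"
    then obtain e where e: "e \<in> E" "x = R g v + e" by (auto simp: add_coset_def)
    then have "x = R g (v + R (inv g) e)" using g by (simp add: R_add R_inv)
    moreover have "R (inv g) e \<in> E" using subrep_action[OF E] g e by simp
    ultimately show "x \<in> R g ` add_coset E v" unfolding add_coset_def by blast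
  qed
  then show ?thesis by (simp add: quotient_rep_def)
qed

text \<open>A closed invariant subspace \<open>U\<close> of the quotient pulls back to a
  subrepresentation between \<open>E\<close> and \<open>F\<close>: the quotient map is continuous
  and \<open>F\<close> is closed.\<close>

lemma irreducible_quotient:
  assumes F: "subrep G R F" and sub: "E \<subset> F"
    and simple: "\<And>W. subrep G R W \<Longrightarrow> E \<subseteq> W \<Longrightarrow> W \<subseteq> F \<Longrightarrow> W = E \<or> W = F"
  shows "irreducible_rep G (quotient_rep R F E)"
  unfolding irreducible_rep_def
proof (intro conjI allI impI)
  let ?Q = "quotient_rep R F E"
  obtain v where v: "v \<in> F" "v \<notin> E" using sub by blast
  have "add_coset E v \<noteq> E" using v(2) add_coset_eq_iff_subrep[of v 0] by (simp add: add_coset_zero)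
  then show "rspace ?Q \<noteq> {rzero ?Q}" using v(1) by (auto simp: rspace_quotient quotient_zero)
  fix U assume U: "closed_invariant_subspace G ?Q U"
  define W where "W = {v \<in> F. add_coset E v \<in> U}"
  have Usub: "U \<subseteq> add_coset E ` F"
    using U closedin_subset rspace_quotient unfolding closed_invariant_subspace_def by blast
  have EU: "E \<in> U" using U by (simp add: closed_invariant_subspace_def quotient_zero)
  have "closedin (top_of_set F) W"
    using closedin_continuous_map_preimage[OF quotient_imp_continuous_map[OF quotient_map_quotient_rep], of R F E U]
      U unfolding closed_invariant_subspace_def W_def by simp
  then have "closed W" using closedin_closed_trans subrep_closed[OF F] by blast
  moreover have "0 \<in> W" using EU subrep_zero[OF F] by (simp add: W_def add_coset_zero)
  moreover have "x + y \<in> W" if "x \<in> W" "y \<in> W" for x y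
    using that U subrep_add[OF F] by (auto simp: W_def closed_invariant_subspace_def quotient_add[symmetric, where F = F])
  moreover have "c *\<^sub>C x \<in> W" if "x \<in> W" for c x
    using that U subrep_scaleC[OF F] by (auto simp: W_def closed_invariant_subspace_def quotient_scale[symmetric, where F = F])
  moreover have "R g x \<in> W" if "g \<in> carrier G" "x \<in> W" for g x
    using that U subrep_action[OF F] by (auto simp: W_def closed_invariant_subspace_def quotient_action[symmetric, where F = F])
  ultimately have "subrep G R W" by (simp add: subrep_iff)
  moreover have "E \<subseteq> W"
  proof
    fix x assume "x \<in> E"
    then have "add_coset E x = E" using add_coset_eq_iff_subrep[of x 0] by (simp add: add_coset_zero)
    then show "x \<in> W" using \<open>x \<in> E\<close> sub EU by (auto simp: W_def)
  qed
  moreover have "W \<subseteq> F" by (auto simp: W_def)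
  ultimately have "W = E \<or> W = F" by (rule simple)
  moreover have UW: "U = add_coset E ` W" using Usub by (auto simp: W_def)
  ultimately show "U = {rzero ?Q} \<or> U = rspace ?Q"
  proof (elim disjE)
    assume "W = E"
    moreover have "add_coset E x = E" if "x \<in> E" for x
      using that add_coset_eq_iff_subrep[of x 0] by (simp add: add_coset_zero)
    ultimately show ?thesis using UW subrep_zero[OF E] by (auto simp: quotient_zero)
  qed (simp add: UW rspace_quotient)
qed

end

end

section \<open>Maximal chains of subrepresentations\<close>

text \<open>Maximality is phrased as a membership test: to lie in \<open>L\<close>, a
  subrepresentation only has to be comparable with every member.\<close>

locale maximal_chain_of_subreps = compact_rep G X \<mu> R
  for G :: "('g, 'm) monoid_scheme" (structure) and X and \<mu>
    and R :: "'g \<Rightarrow> 'v::complex_hilbert \<Rightarrow> 'v" +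
  fixes L :: "'v set set"
  assumes L_subrep: "E \<in> L \<Longrightarrow> subrep G R E"
    and L_chain: "E \<in> L \<Longrightarrow> F \<in> L \<Longrightarrow> E \<subseteq> F \<or> F \<subseteq> E"
    and L_maximal: "subrep G R E \<Longrightarrow> (\<And>F. F \<in> L \<Longrightarrow> E \<subseteq> F \<or> F \<subseteq> E) \<Longrightarrow> E \<in> L"

lemma (in compact_rep) exists_maximal_chain: "\<exists>L. maximal_chain_of_subreps G X \<mu> R L"
proof -
  let ?A = "{E. subrep G R E}"
  obtain L where L: "subset.maxchain ?A L" using subset.Hausdorff by blast
  then have chain: "L \<subseteq> ?A" "\<And>E F. E \<in> L \<Longrightarrow> F \<in> L \<Longrightarrow> E \<subseteq> F \<or> F \<subseteq> E"
    by (auto simp: subset.maxchain_def subset.chain_def)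
  have "E \<in> L" if E: "subrep G R E" "\<And>F. F \<in> L \<Longrightarrow> E \<subseteq> F \<or> F \<subseteq> E" for E
  proof (rule ccontr)
    assume "E \<notin> L"
    moreover have "subset.chain ?A (insert E L)"
      using chain E unfolding subset.chain_def by blast
    ultimately show False using L unfolding subset.maxchain_def by blast
  qed
  then show ?thesis
    using chain by (intro exI[of _ L] maximal_chain_of_subreps.intro
        maximal_chain_of_subreps_axioms.intro compact_rep_axioms) auto
qed

context maximal_chain_of_subreps
begin

text \<open>Each \<open>F\<close> in \<open>L\<close> either lies inside some member of the family
  or contains all of them, and in the latter case, being closed, also the closure. The empty family
  puts the zero space into \<open>L\<close>; dually, the empty intersection puts in the whole
  space.\<close>

lemma closure_Union_in_L:
  assumes "\<C> \<subseteq> L"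
  shows "closure (insert 0 (\<Union>\<C>)) \<in> L"
proof (rule L_maximal)
  show "subrep G R (closure (insert 0 (\<Union>\<C>)))"
    using assms by (intro subrep_closure_Union L_subrep L_chain) auto
  fix F assume F: "F \<in> L"
  show "closure (insert 0 (\<Union>\<C>)) \<subseteq> F \<or> F \<subseteq> closure (insert 0 (\<Union>\<C>))"
  proof (cases "\<exists>c\<in>\<C>. F \<subseteq> c")
    case True
    then have "F \<subseteq> insert 0 (\<Union>\<C>)" by blast
    then show ?thesis using closure_subset by blast
  next
    case False
    then have "c \<subseteq> F" if "c \<in> \<C>" for c using that L_chain[OF F, of c] assms by blast
    then have "insert 0 (\<Union>\<C>) \<subseteq> F" using subrep_zero[OF L_subrep[OF F]] by blast
    then show ?thesis using closure_minimal[OF _ subrep_closed[OF L_subrep[OF F]]] by blast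
  qed
qed

lemma Inter_in_L:
  assumes "\<C> \<subseteq> L"
  shows "\<Inter>\<C> \<in> L"
proof (rule L_maximal)
  show "subrep G R (\<Inter>\<C>)" using assms by (intro subrep_Inter L_subrep) auto
  fix F assume F: "F \<in> L"
  show "\<Inter>\<C> \<subseteq> F \<or> F \<subseteq> \<Inter>\<C>"
  proof (cases "\<exists>c\<in>\<C>. c \<subseteq> F")
    case False
    then have "F \<subseteq> c" if "c \<in> \<C>" for c using that L_chain[OF F, of c] assms by blast
    then show ?thesis by blast
  qed blast
qed

definition jump :: "'v set \<Rightarrow> 'v set \<Rightarrow> bool" where
  "jump E F \<longleftrightarrow> E \<in> L \<and> F \<in> L \<and> E \<subset> F \<and> \<not> (\<exists>c\<in>L. E \<subset> c \<and> c \<subset> F)"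

text \<open>Every member of \<open>L\<close> lies below \<open>E\<close> or above \<open>F\<close>,
  so a subrepresentation between the two is comparable with all of \<open>L\<close> and belongs to
  it by maximality.\<close>

lemma irreducible_jump:
  assumes "jump E F"
  shows "irreducible_rep G (quotient_rep R F E)"
proof (rule irreducible_quotient)
  have L: "E \<in> L" "F \<in> L" "E \<subset> F" and no: "\<And>c. c \<in> L \<Longrightarrow> E \<subset> c \<Longrightarrow> c \<subset> F \<Longrightarrow> False"
    using assms by (auto simp: jump_def)
  show "subrep G R E" "subrep G R F" "E \<subset> F" using L L_subrep by auto
  fix W assume W: "subrep G R W" "E \<subseteq> W" "W \<subseteq> F"
  have "W \<subseteq> c \<or> c \<subseteq> W" if c: "c \<in> L" for c
    using L_chain[OF c L(1)] L_chain[OF c L(2)] no[OF c] W(2,3) by blast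
  then have "W \<in> L" using W(1) L_maximal by blast
  then show "W = E \<or> W = F" using no W(2,3) by blast
qed

text \<open>A cut of the chain yields a jump only if its lower half has a largest and its upper half
  a least element. The cut by whether the trace on V^K stays in \<open>s\<close> has both: the lower
  one by continuity of the averaging, the upper one by compactness.\<close>

lemma exists_jump_between:
  assumes s: "s \<in> L" and a: "a \<in> L" and sa: "s \<subset> a"
  shows "\<exists>E F. jump E F \<and> s \<subseteq> E \<and> F \<subseteq> a"
proof -
  obtain K x where K: "compact_open_subgroup K" and x: "x \<in> a" "x \<in> fixed_vectors K" "x \<notin> s"
    using exists_fixed_vector_outside[OF L_subrep[OF s] L_subrep[OF a] sa] by blast
  let ?V = "fixed_vectors K"
  define A where "A = {c \<in> L. c \<inter> ?V \<subseteq> s}"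
  define B where "B = {c \<in> L. \<not> c \<inter> ?V \<subseteq> s}"
  define E where "E = closure (insert 0 (\<Union>A))"
  define F where "F = \<Inter>B"
  have AL: "A \<subseteq> L" and BL: "B \<subseteq> L" and AB: "A \<union> B = L"
    and sA: "s \<in> A" and aB: "a \<in> B" using s a x by (auto simp: A_def B_def)
  have A_less_B: "c \<subseteq> d" if "c \<in> A" "d \<in> B" for c d
    using that L_chain[of c d] unfolding A_def B_def by blast
  have EL: "E \<in> L" and FL: "F \<in> L"
    unfolding E_def F_def using AL BL by (simp_all add: closure_Union_in_L Inter_in_L)
  have cE: "c \<subseteq> E" if "c \<in> A" for c
    using that closure_subset[of "insert 0 (\<Union>A)"] by (auto simp: E_def)
  have Fc: "F \<subseteq> c" if "c \<in> B" for c using that by (auto simp: F_def)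
  \<comment> \<open>On a member of \<open>A\<close>, averaging lands in its trace on V^K, hence in
    \<open>s\<close>; continuity extends this to \<open>E\<close>. On the fixed vectors of
    \<open>E\<close> averaging is the identity, so \<open>E\<close> itself belongs to
    \<open>A\<close>.\<close>
  have "average K ` E \<subseteq> s"
    unfolding E_def
  proof (rule image_closure_subset)
    show "continuous_on (closure (insert 0 (\<Union>A))) (average K)"
      using bounded_linear_average[OF K] by (rule linear_continuous_on)
    show "closed s" using subrep_closed[OF L_subrep[OF s]] .
    have "average K y \<in> s" if "y \<in> c" "c \<in> A" for y c
      using that average_in_subrep[OF K L_subrep that(1)] average_in_fixed[OF K, of y] AL
      unfolding A_def by blast
    moreover have "average K 0 \<in> s"
      using average_in_subrep[OF K L_subrep[OF s] subrep_zero[OF L_subrep[OF s]]] .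
    ultimately show "average K ` insert 0 (\<Union>A) \<subseteq> s" by blast
  qed
  then have EA: "E \<in> A" using EL average_fixed[OF K] by (force simp: A_def)
  have FB: "F \<in> B"
  proof -
    \<comment> \<open>A decreasing family of subspaces of the fixed vectors, none of them inside \<open>s\<close>, has an
      intersection not inside \<open>s\<close>: unit vectors orthogonal to \<open>s\<close> form a compact set.\<close>
    define D where "D = (?V \<inter> cball 0 1) \<inter> ({e. norm e = 1} \<inter> (\<Inter>y\<in>s \<inter> ?V. {e. inner e y = 0}))"
    have "closed {e. inner e y = 0}" for y :: 'v
      by (intro closed_Collect_eq continuous_intros)
    moreover have "closed {e::'v. norm e = 1}"
      by (intro closed_Collect_eq continuous_intros)
    ultimately have "compact D"
      unfolding D_def
      by (intro compact_Int_closed[OF compact_unit_ball_fixed_vectors[OF K]] closed_Int closed_INT) auto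
    then have "D \<inter> (\<Inter>c\<in>B. c) \<noteq> {}"
    proof (rule compact_imp_fip_image)
      show "closed c" if "c \<in> B" for c using that BL subrep_closed[OF L_subrep] by blast
      fix \<C> assume \<C>: "finite \<C>" "\<C> \<subseteq> B"
      \<comment> \<open>Adding \<open>a\<close> keeps the finite family nonempty, so that it has a
        least member.\<close>
      have CL: "insert a \<C> \<subseteq> L" using \<C> aB BL by blast
      have "\<exists>c\<in>insert a \<C>. \<forall>d\<in>insert a \<C>. c \<subseteq> d"
      proof (rule finite_chain_least)
        show "c \<subseteq> d \<or> d \<subseteq> c" if "c \<in> insert a \<C>" "d \<in> insert a \<C>" for c d
          using that CL L_chain[of c d] by blast
      qed (use \<C> in auto)
      then obtain c where c: "c \<in> insert a \<C>" "\<forall>d\<in>insert a \<C>. c \<subseteq> d" by blast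
      then have cB: "c \<in> B" and cL: "c \<in> L" using \<C>(2) aB CL by blast+
      then obtain y where y: "y \<in> c \<inter> ?V" "y \<notin> s \<inter> ?V" by (auto simp: B_def)
      have "\<exists>e\<in>c \<inter> ?V. norm e = 1 \<and> (\<forall>y\<in>s \<inter> ?V. inner e y = 0)"
      proof (rule orthogonal_unit_vector[OF _ _ _ _ y])
        show "subspace (s \<inter> ?V)" "subspace (c \<inter> ?V)"
          using subspace_inter[OF subspace_subrep[OF L_subrep] subspace_fixed_vectors[OF K]] s cL by auto
        show "closed (s \<inter> ?V)"
          using closed_fixed_vectors[OF K] subrep_closed[OF L_subrep[OF s]] by (rule closed_Int[rotated])
        show "s \<inter> ?V \<subseteq> c \<inter> ?V" using A_less_B[OF sA cB] by blast
      qed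
      then obtain e where "e \<in> c" "e \<in> D" by (auto simp: D_def)
      then show "D \<inter> (\<Inter>c\<in>\<C>. c) \<noteq> {}" using c(2) by blast
    qed
    then obtain e where e: "e \<in> D" "e \<in> F" by (auto simp: F_def)
    have "e \<notin> s"
    proof
      assume "e \<in> s"
      then have "inner e e = 0" using e(1) by (auto simp: D_def)
      then show False using e(1) by (auto simp: D_def)
    qed
    then show ?thesis using e FL by (auto simp: B_def D_def)
  qed
  have "E \<noteq> F" using EA FB by (auto simp: A_def B_def)
  then have "E \<subset> F" using A_less_B[OF EA FB] by blast
  moreover have "\<not> (E \<subset> c \<and> c \<subset> F)" if "c \<in> L" for c
    using that AB cE[of c] Fc[of c] by blast
  ultimately have "jump E F" using EL FL by (auto simp: jump_def)
  then show ?thesis using cE[OF sA] Fc[OF aB] by blast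
qed

section \<open>The maximal chain as a ladder and a complete filtration\<close>

definition inclusion :: "'v set rel" where
  "inclusion = {(E, F). E \<in> L \<and> F \<in> L \<and> E \<subseteq> F}"

lemma less_in_inclusion: "less_in inclusion E F \<longleftrightarrow> E \<in> L \<and> F \<in> L \<and> E \<subset> F"
  by (auto simp: less_in_def inclusion_def)

lemma neighbours_inclusion: "neighbours L inclusion = jump"
  by (auto simp: fun_eq_iff neighbours_def jump_def less_in_inclusion)

lemma jumpD: "jump E F \<Longrightarrow> E \<in> L \<and> F \<in> L \<and> E \<subset> F"
  by (simp add: jump_def)

text \<open>An upper bound \<open>u\<close> strictly below \<open>a\<close> would leave a jump
  between \<open>u\<close> and \<open>a\<close>. Its upper end has a neighbour, so it is not
  \<open>a\<close>; hence it lies below \<open>a\<close> and must be below \<open>u\<close>, which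
  is absurd. The infimum uses the lower end of a jump above \<open>a\<close>.\<close>

lemma ladder_inclusion: "ladder L inclusion"
  unfolding ladder_def
proof (intro conjI ballI)
  show "linear_order_on L inclusion"
    using L_chain
    by (auto simp: order_on_defs inclusion_def refl_on_def trans_def antisym_def total_on_def)
  let ?N = "having_neighbour L inclusion"
  have N: "E \<in> ?N" "F \<in> ?N" if "jump E F" for E F
    using that jumpD by (auto simp: having_neighbour_def neighbours_inclusion)
  fix a assume "a \<in> L - ?N"
  then have a: "a \<in> L" "a \<notin> ?N" by auto
  show "is_sup_in L inclusion {b \<in> ?N. less_in inclusion b a} a"
    unfolding is_sup_in_def
  proof (intro conjI ballI impI)
    fix u assume u: "u \<in> L" "\<forall>b\<in>{b \<in> ?N. less_in inclusion b a}. (b, u) \<in> inclusion"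
    show "(a, u) \<in> inclusion"
    proof (rule ccontr)
      assume "(a, u) \<notin> inclusion"
      then have "u \<subset> a" using u(1) a(1) L_chain[of a u] by (auto simp: inclusion_def)
      then obtain E F where EF: "jump E F" "u \<subseteq> E" "F \<subseteq> a"
        using exists_jump_between[OF u(1) a(1)] by blast
      then have "F \<noteq> a" using a(2) N by blast
      then have "less_in inclusion F a"
        using EF(3) jumpD[OF EF(1)] a(1) by (simp add: less_in_inclusion psubset_eq)
      then have "(F, u) \<in> inclusion" using u(2) N(2)[OF EF(1)] by simp
      then have "F \<subseteq> u" by (simp add: inclusion_def)
      then show False using EF(2) jumpD[OF EF(1)] by blast
    qed
  qed (use a in \<open>auto simp: less_in_def\<close>)
  show "is_inf_in L inclusion {c \<in> ?N. less_in inclusion a c} a"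
    unfolding is_inf_in_def
  proof (intro conjI ballI impI)
    fix u assume u: "u \<in> L" "\<forall>c\<in>{c \<in> ?N. less_in inclusion a c}. (u, c) \<in> inclusion"
    show "(u, a) \<in> inclusion"
    proof (rule ccontr)
      assume "(u, a) \<notin> inclusion"
      then have "a \<subset> u" using u(1) a(1) L_chain[of a u] by (auto simp: inclusion_def)
      then obtain E F where EF: "jump E F" "a \<subseteq> E" "F \<subseteq> u"
        using exists_jump_between[OF a(1) u(1)] by blast
      then have "E \<noteq> a" using a(2) N by blast
      then have "less_in inclusion a E"
        using EF(2) jumpD[OF EF(1)] a(1) by (simp add: less_in_inclusion psubset_eq)
      then have "(u, E) \<in> inclusion" using u(2) N(1)[OF EF(1)] by simp
      then have "u \<subseteq> E" by (simp add: inclusion_def)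
      then show False using EF(3) jumpD[OF EF(1)] by blast
    qed
  qed (use a in \<open>auto simp: less_in_def\<close>)
qed

text \<open>Both sides of the limit condition are members of \<open>L\<close> with no member
  strictly between. If they differed, they would form a jump across the cut, which
  \<open>gap\<close> rules out.\<close>

theorem complete_filtration_inclusion: "complete_filtration G R L inclusion (\<lambda>E. E)"
  unfolding complete_filtration_def neighbours_inclusion
proof (intro conjI ballI allI impI)
  show "ladder L inclusion" by (rule ladder_inclusion)
  fix A B
  assume AB: "A \<union> B = L" "A \<inter> B = {}" "\<forall>a\<in>A. \<forall>b\<in>B. less_in inclusion a b"
    and gap: "\<not> (\<exists>a\<in>A. \<exists>b\<in>B. jump a b)"
  define E where "E = closure (insert 0 (\<Union>a\<in>A. a))"
  define F where "F = (\<Inter>b\<in>B. b)"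
  have EL: "E \<in> L" and FL: "F \<in> L"
    using closure_Union_in_L[of A] Inter_in_L[of B] AB(1) by (auto simp: E_def F_def)
  have aE: "a \<subseteq> E" if "a \<in> A" for a
    using that closure_subset[of "insert 0 (\<Union>a\<in>A. a)"] by (auto simp: E_def)
  have Fb: "F \<subseteq> b" if "b \<in> B" for b using that by (auto simp: F_def)
  have "insert 0 (\<Union>a\<in>A. a) \<subseteq> F"
    using AB(3) subrep_zero[OF L_subrep[OF FL]] by (auto simp: less_in_inclusion F_def)
  then have "E \<subseteq> F"
    unfolding E_def by (rule closure_minimal) (rule subrep_closed[OF L_subrep[OF FL]])
  have "E = F"
  proof (rule ccontr)
    assume "E \<noteq> F"
    with \<open>E \<subseteq> F\<close> have lt: "E \<subset> F" by blast
    have "E \<notin> B" "F \<notin> A" using lt aE[of F] Fb[of E] by auto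
    then have "E \<in> A" "F \<in> B" using EL FL AB(1) by auto
    have "\<not> (E \<subset> c \<and> c \<subset> F)" if "c \<in> L" for c
      using that AB(1) aE[of c] Fb[of c] by blast
    then have "jump E F" using lt EL FL by (auto simp: jump_def)
    then show False using gap \<open>E \<in> A\<close> \<open>F \<in> B\<close> by blast
  qed
  then show "closure (insert 0 (\<Union>a\<in>A. a)) = (\<Inter>b\<in>B. b)" by (simp add: E_def F_def)
qed (auto simp: L_subrep less_in_inclusion irreducible_jump)

end

section \<open>Multiplicities\<close>

text \<open>Orthonormal vectors have squared distance 2, while points of one ball of radius 1/2 are
  less than 1 apart. The number of centres of a finite cover by such balls is therefore a bound,
  whatever \<open>k\<close> and \<open>e\<close> are.\<close>

lemma orthonormal_family_bound:
  fixes S :: "'a::real_inner set"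
  assumes "compact S"
  shows "\<exists>N. \<forall>k (e :: nat \<Rightarrow> 'a). (\<forall>j\<in>{1..k}. e j \<in> S \<and> norm (e j) = 1) \<and>
    (\<forall>i\<in>{1..k}. \<forall>j\<in>{1..k}. i < j \<longrightarrow> inner (e j) (e i) = 0) \<longrightarrow> k \<le> N"
proof -
  obtain T where T: "finite T" "S \<subseteq> (\<Union>x\<in>T. ball x (1/2))"
    using assms unfolding compact_eq_totally_bounded by (meson half_gt_zero zero_less_one)
  show ?thesis
  proof (intro exI[of _ "card T"] allI impI)
    fix k and e :: "nat \<Rightarrow> 'a"
    assume "(\<forall>j\<in>{1..k}. e j \<in> S \<and> norm (e j) = 1) \<and>
      (\<forall>i\<in>{1..k}. \<forall>j\<in>{1..k}. i < j \<longrightarrow> inner (e j) (e i) = 0)"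
    then have e: "\<And>j. j \<in> {1..k} \<Longrightarrow> e j \<in> S \<and> norm (e j) = 1"
      and orth: "\<And>i j. i \<in> {1..k} \<Longrightarrow> j \<in> {1..k} \<Longrightarrow> i < j \<Longrightarrow> inner (e j) (e i) = 0"
      by simp_all
    have "\<forall>j\<in>{1..k}. \<exists>x\<in>T. e j \<in> ball x (1/2)" using e T(2) by blast
    then obtain t where t: "\<And>j. j \<in> {1..k} \<Longrightarrow> t j \<in> T \<and> e j \<in> ball (t j) (1/2)" by metis
    have apart: "t i \<noteq> t j" if ij: "i \<in> {1..k}" "j \<in> {1..k}" "i < j" for i j
    proof
      assume "t i = t j"
      then have "dist (e i) (e j) < 1"
        using t[OF ij(1)] t[OF ij(2)] dist_triangle_half_r[of "t j" "e i" 1 "e j"] by simp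
      then have "(norm (e j - e i))\<^sup>2 < 1"
        by (simp add: dist_norm norm_minus_commute power_less_one_iff)
      moreover have "(norm (e j - e i))\<^sup>2 = (norm (e j))\<^sup>2 + (norm (e i))\<^sup>2 - 2 * inner (e j) (e i)"
        unfolding power2_norm_eq_inner by (simp add: inner_diff_left inner_diff_right inner_commute)
      ultimately show False using e[OF ij(1)] e[OF ij(2)] orth[OF ij] by simp
    qed
    have "inj_on t {1..k}"
    proof (rule inj_onI)
      fix i j assume "i \<in> {1..k}" "j \<in> {1..k}" "t i = t j"
      then show "i = j" using apart[of i j] apart[of j i] by (cases i j rule: linorder_cases) auto
    qed
    moreover have "t ` {1..k} \<subseteq> T" using t by blast
    ultimately show "k \<le> card T" using card_inj_on_le[OF _ _ T(1), of t "{1..k}"] by simp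
  qed
qed

context compact_rep
begin

text \<open>A fixed vector of \<open>\<pi>\<close> lifts, by averaging, to a fixed vector of every subquotient isomorphic
  to \<open>\<pi>\<close>. That it is nonzero is expressed as \<open>p + p \<noteq> p\<close>, which isomorphisms visibly preserve.\<close>

lemma fixed_vector_lift:
  assumes E: "subrep G R E" and F: "subrep G R F" and K: "compact_open_subgroup K"
    and iso: "isomorphic_rep G (quotient_rep R F E) \<pi>"
    and p: "p \<in> rspace \<pi>" "radd \<pi> p p \<noteq> p" "\<And>g. g \<in> K \<Longrightarrow> ract \<pi> g p = p"
  shows "\<exists>y\<in>F. y \<in> fixed_vectors K \<and> y \<notin> E"
proof -
  let ?Q = "quotient_rep R F E"
  obtain \<phi> where \<phi>: "homeomorphic_map (rtop ?Q) (rtop \<pi>) \<phi>"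
    and add: "\<And>x y. x \<in> rspace ?Q \<Longrightarrow> y \<in> rspace ?Q \<Longrightarrow> \<phi> (radd ?Q x y) = radd \<pi> (\<phi> x) (\<phi> y)"
    and act: "\<And>g x. g \<in> carrier G \<Longrightarrow> x \<in> rspace ?Q \<Longrightarrow> \<phi> (ract ?Q g x) = ract \<pi> g (\<phi> x)"
    using iso unfolding isomorphic_rep_def by blast
  note coset_eq = add_coset_eq_iff[OF subspace_subrep[OF E]]
  have inj: "inj_on \<phi> (rspace ?Q)" using \<phi> by (rule homeomorphic_imp_injective_map)
  have "p \<in> \<phi> ` rspace ?Q" using homeomorphic_imp_surjective_map[OF \<phi>] p(1) by simp
  then obtain y where y: "y \<in> F" "\<phi> (add_coset E y) = p" by (auto simp: rspace_quotient)
  have mem: "add_coset E z \<in> rspace ?Q" if "z \<in> F" for z using that by (simp add: rspace_quotient)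
  have yE: "y \<notin> E"
  proof
    assume "y \<in> E"
    then have "add_coset E (y + y) = add_coset E y" by (simp add: coset_eq)
    then show False using add[OF mem[OF y(1)] mem[OF y(1)]] y p(2) by (simp add: quotient_add[OF E])
  qed
  have "R g y - y \<in> E" if g: "g \<in> K" for g
  proof -
    have gG: "g \<in> carrier G" using g K_subset[OF K] by blast
    then have "\<phi> (add_coset E (R g y)) = \<phi> (add_coset E y)"
      using act[OF gG mem[OF y(1)]] y p(3)[OF g] by (simp add: quotient_action[OF E])
    then have "add_coset E (R g y) = add_coset E y"
      using inj mem[OF y(1)] mem[OF subrep_action[OF F gG y(1)]] by (simp add: inj_on_eq_iff)
    then show ?thesis by (simp add: coset_eq)
  qed
  \<comment> \<open>The coset of \<open>y\<close> is fixed by \<open>K\<close>, so averaging only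
    changes its representative, and the new one is a fixed vector.\<close>
  then have "average K y - y \<in> E"
    by (intro average_diff_in[OF K] subspace_subrep[OF E] subrep_closed[OF E])
  then have "average K y \<notin> E"
    using yE subspace_diff[OF subspace_subrep[OF E], of "average K y" "average K y - y"] by auto
  then show ?thesis using average_in_subrep[OF K F y(1)] average_in_fixed[OF K] by blast
qed

text \<open>Moves a fixed vector found in one occurrence to \<open>\<pi>\<close> itself, where the
  choice of that occurrence no longer matters.\<close>

lemma fixed_vector_descend:
  assumes E: "subrep G R E" and F: "subrep G R F" and K: "compact_open_subgroup K"
    and iso: "isomorphic_rep G (quotient_rep R F E) \<pi>"
    and v: "v \<in> F" "v \<in> fixed_vectors K" "v \<notin> E"
  shows "\<exists>p\<in>rspace \<pi>. radd \<pi> p p \<noteq> p \<and> (\<forall>g\<in>K. ract \<pi> g p = p)"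
proof -
  let ?Q = "quotient_rep R F E"
  obtain \<phi> where \<phi>: "homeomorphic_map (rtop ?Q) (rtop \<pi>) \<phi>"
    and add: "\<And>x y. x \<in> rspace ?Q \<Longrightarrow> y \<in> rspace ?Q \<Longrightarrow> \<phi> (radd ?Q x y) = radd \<pi> (\<phi> x) (\<phi> y)"
    and act: "\<And>g x. g \<in> carrier G \<Longrightarrow> x \<in> rspace ?Q \<Longrightarrow> \<phi> (ract ?Q g x) = ract \<pi> g (\<phi> x)"
    using iso unfolding isomorphic_rep_def by blast
  note coset_eq = add_coset_eq_iff[OF subspace_subrep[OF E]]
  have inj: "inj_on \<phi> (rspace ?Q)" using \<phi> by (rule homeomorphic_imp_injective_map)
  let ?p = "\<phi> (add_coset E v)"
  have mem: "add_coset E z \<in> rspace ?Q" if "z \<in> F" for z using that by (simp add: rspace_quotient)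
  have "?p \<in> rspace \<pi>" using homeomorphic_imp_surjective_map[OF \<phi>] mem[OF v(1)] by blast
  moreover have "radd \<pi> ?p ?p \<noteq> ?p"
  proof
    assume "radd \<pi> ?p ?p = ?p"
    then have "\<phi> (add_coset E (v + v)) = \<phi> (add_coset E v)"
      using add[OF mem[OF v(1)] mem[OF v(1)]] by (simp add: quotient_add[OF E])
    then have "add_coset E (v + v) = add_coset E v"
      using inj mem[OF v(1)] mem[OF subrep_add[OF F v(1) v(1)]] by (simp add: inj_on_eq_iff)
    then show False using v(3) by (simp add: coset_eq)
  qed
  moreover have "ract \<pi> g ?p = ?p" if "g \<in> K" for g
  proof -
    have "g \<in> carrier G" "R g v = v" using that K_subset[OF K] v(2) by (auto simp: fixed_vectors_def)
    then show ?thesis using act[OF _ mem[OF v(1)], of g] by (simp add: quotient_action[OF E])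
  qed
  ultimately show ?thesis by blast
qed

text \<open>The bound must not depend on the filtration, so \<open>K\<close> is taken from a single
  occurrence of \<open>\<pi>\<close>; the fixed vector found there passes to \<open>\<pi>\<close>
  and from \<open>\<pi>\<close> to all other occurrences.\<close>

theorem multiplicity_finite:
  assumes \<pi>: "continuous_rep G X \<pi>" "irreducible_rep G \<pi>"
  shows "multiplicity_of G R \<pi> < \<infinity>"
proof -
  define filtration where "filtration k F \<longleftrightarrow> (\<forall>i\<in>{1..2 * k}. subrep G R (F i)) \<and>
       (\<forall>i\<in>{1..2 * k}. \<forall>j\<in>{1..2 * k}. i \<le> j \<longrightarrow> F i \<subseteq> F j) \<and>
       (\<forall>j\<in>{1..k}. isomorphic_rep G (quotient_rep R (F (2 * j)) (F (2 * j - 1))) \<pi>)"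
    for k and F :: "nat \<Rightarrow> 'v set"
  have "\<exists>N. \<forall>k F. filtration k F \<longrightarrow> k \<le> N"
  proof (cases "\<exists>k F. filtration k F \<and> k \<ge> 1")
    case False
    then show ?thesis by (metis not_less_eq_eq One_nat_def le0)
  next
    case True
    then obtain k0 F0 where F0: "filtration k0 F0" "k0 \<ge> 1" by blast
    then have sub: "subrep G R (F0 1)" "subrep G R (F0 2)" "F0 1 \<subseteq> F0 2"
      by (auto simp: filtration_def)
    have "isomorphic_rep G (quotient_rep R (F0 (2 * 1)) (F0 (2 * 1 - 1))) \<pi>"
      using F0 unfolding filtration_def by (meson atLeastAtMost_iff order_refl)
    then have iso: "isomorphic_rep G (quotient_rep R (F0 2) (F0 1)) \<pi>" by simp
    \<comment> \<open>If the two were equal, the quotient would be a point and \<open>\<pi>\<close>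
      would consist of its zero alone, contrary to irreducibility.\<close>
    have "F0 1 \<noteq> F0 2"
    proof
      assume eq: "F0 1 = F0 2"
      obtain \<phi> where "homeomorphic_map (rtop (quotient_rep R (F0 2) (F0 1))) (rtop \<pi>) \<phi>"
        using iso unfolding isomorphic_rep_def by blast
      then have "rspace \<pi> = \<phi> ` add_coset (F0 1) ` F0 2"
        using homeomorphic_imp_surjective_map by (metis rspace_quotient)
      moreover have "add_coset (F0 1) x = add_coset (F0 1) 0" if "x \<in> F0 2" for x
        using that eq add_coset_eq_iff[OF subspace_subrep[OF sub(1)], of x 0] by simp
      ultimately have "rspace \<pi> \<subseteq> {\<phi> (add_coset (F0 1) 0)}" by auto
      moreover have "rzero \<pi> \<in> rspace \<pi>" "rspace \<pi> \<noteq> {rzero \<pi>}"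
        using \<pi> by (auto simp: continuous_rep_def complex_tvs_def irreducible_rep_def)
      ultimately show False by (auto dest: subset_singletonD)
    qed
    then have "F0 1 \<subset> F0 2" using sub(3) by blast
    then obtain K v where K: "compact_open_subgroup K"
      and v: "v \<in> F0 2" "v \<in> fixed_vectors K" "v \<notin> F0 1"
      by (rule exists_fixed_vector_outside[OF sub(1,2)])
    obtain p where p: "p \<in> rspace \<pi>" "radd \<pi> p p \<noteq> p" "\<And>g. g \<in> K \<Longrightarrow> ract \<pi> g p = p"
      using fixed_vector_descend[OF sub(1,2) K iso v] by blast
    let ?V = "fixed_vectors K"
    obtain N where N: "\<forall>k (e :: nat \<Rightarrow> 'v). (\<forall>j\<in>{1..k}. e j \<in> ?V \<inter> cball 0 1 \<and> norm (e j) = 1) \<and>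
        (\<forall>i\<in>{1..k}. \<forall>j\<in>{1..k}. i < j \<longrightarrow> inner (e j) (e i) = 0) \<longrightarrow> k \<le> N"
      using orthonormal_family_bound[OF compact_unit_ball_fixed_vectors[OF K]] by (rule exE)
    have "k \<le> N" if Fk: "filtration k F" for k F
    proof -
      have F: "subrep G R (F i)" if "i \<in> {1..2 * k}" for i
        using Fk that by (simp add: filtration_def)
      have mono: "F i \<subseteq> F j" if "i \<in> {1..2 * k}" "j \<in> {1..2 * k}" "i \<le> j" for i j
        using Fk that by (simp add: filtration_def)
      have "\<exists>e\<in>F (2 * j) \<inter> ?V. norm e = 1 \<and> (\<forall>y\<in>F (2 * j - 1) \<inter> ?V. inner e y = 0)"
        if j: "j \<in> {1..k}" for j
      proof -
        have ix: "2 * j - 1 \<in> {1..2 * k}" "2 * j \<in> {1..2 * k}" using j by auto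
        have "isomorphic_rep G (quotient_rep R (F (2 * j)) (F (2 * j - 1))) \<pi>"
          using Fk j by (simp add: filtration_def)
        then obtain y where y: "y \<in> F (2 * j)" "y \<in> ?V" "y \<notin> F (2 * j - 1)"
          using fixed_vector_lift[OF F[OF ix(1)] F[OF ix(2)] K _ p] by blast
        have S: "subspace (F i \<inter> ?V)" if "i \<in> {1..2 * k}" for i
          using subspace_inter[OF subspace_subrep[OF F[OF that]] subspace_fixed_vectors[OF K]] .
        show ?thesis
        proof (rule orthogonal_unit_vector)
          show "closed (F (2 * j - 1) \<inter> ?V)"
            using subrep_closed[OF F[OF ix(1)]] closed_fixed_vectors[OF K] by (rule closed_Int)
          show "F (2 * j - 1) \<inter> ?V \<subseteq> F (2 * j) \<inter> ?V" using mono[OF ix] by auto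
        qed (use S ix y in auto)
      qed
      then obtain e where e: "\<And>j. j \<in> {1..k} \<Longrightarrow> e j \<in> F (2 * j) \<inter> ?V \<and> norm (e j) = 1 \<and>
          (\<forall>y\<in>F (2 * j - 1) \<inter> ?V. inner (e j) y = 0)"
        by metis
      \<comment> \<open>For \<open>i < j\<close> the index \<open>2 * i\<close> is at most
        \<open>2 * j - 1\<close>, so \<open>e i\<close> lies in the space to which
        \<open>e j\<close> was chosen orthogonal.\<close>
      have orth: "inner (e j) (e i) = 0" if ij: "i \<in> {1..k}" "j \<in> {1..k}" "i < j" for i j
      proof -
        have "F (2 * i) \<subseteq> F (2 * j - 1)" using ij by (intro mono) auto
        then show ?thesis using e[OF ij(1)] e[OF ij(2)] by blast
      qed
      show "k \<le> N"
      proof (rule N[THEN spec, THEN spec, THEN mp], intro conjI ballI impI)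
        show "e j \<in> ?V \<inter> cball 0 1" "norm (e j) = 1" if "j \<in> {1..k}" for j
          using e[OF that] by simp_all
      qed (rule orth)
    qed
    then show ?thesis by blast
  qed
  then obtain N where N: "\<And>k F. filtration k F \<Longrightarrow> k \<le> N" by blast
  have "multiplicity_of G R \<pi> \<le> enat N"
    unfolding multiplicity_of_def filtration_def[symmetric]
  proof (rule Sup_least)
    fix x assume "x \<in> {enat k |k. \<exists>F. filtration k F}"
    then obtain k F where "x = enat k" "filtration k F" by (elim CollectE exE conjE)
    then show "x \<le> enat N" using N by simp
  qed
  also have "enat N < \<infinity>" by simp
  finally show ?thesis .
qed

end

theorem theorem3p1:
  fixes G :: "('g, 'm) monoid_scheme"
    and X :: "'g topology"
    and \<mu> :: "'g measure"
    and R :: "'g \<Rightarrow> 'v::complex_hilbert \<Rightarrow> 'v"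
  assumes "topological_group G X"
    and "totally_disconnected_space X"
    and "locally_compact_space X"
    and "haar_measure G X \<mu>"
    and "compact_hilbert_rep G X \<mu> R"
    and "\<exists>v::'v. v \<noteq> 0"
  shows "(\<exists>E F. subrep G R E \<and> subrep G R F \<and> E \<subseteq> F \<and>
              irreducible_rep G (quotient_rep R F E)) \<and>
         (\<exists>(L :: 'v set set) r F. complete_filtration G R L r F) \<and>
         (\<forall>\<pi> :: ('g, 'w) top_rep. continuous_rep G X \<pi> \<and> irreducible_rep G \<pi> \<longrightarrow>
              multiplicity_of G R \<pi> < \<infinity>)"
proof -
  interpret compact_rep G X \<mu> R
    using assms(1-5) by unfold_locales
  obtain L where "maximal_chain_of_subreps G X \<mu> R L" using exists_maximal_chain by blast
  then interpret maximal_chain_of_subreps G X \<mu> R L .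
  \<comment> \<open>Empty families put the zero space and the whole space into \<open>L\<close>; as
    \<open>R\<close> is nonzero they differ, and a jump between them is the irreducible
    subquotient.\<close>
  have "{} \<subseteq> L" by simp
  then have "{0} \<in> L" "UNIV \<in> L"
    using closure_Union_in_L[of "{}"] Inter_in_L[of "{}"] by simp_all
  moreover have "{0::'v} \<subset> UNIV" using assms(6) by blast
  ultimately have "\<exists>E F. jump E F \<and> {0} \<subseteq> E \<and> F \<subseteq> UNIV" by (rule exists_jump_between)
  then obtain E F where "jump E F" by (elim exE conjE)
  then have "subrep G R E \<and> subrep G R F \<and> E \<subseteq> F \<and> irreducible_rep G (quotient_rep R F E)"
    by (simp add: L_subrep jumpD irreducible_jump psubset_imp_subset)
  then have "\<exists>E F. subrep G R E \<and> subrep G R F \<and> E \<subseteq> F \<and> irreducible_rep G (quotient_rep R F E)"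
    by (intro exI)
  moreover have "\<exists>(L :: 'v set set) r F. complete_filtration G R L r F"
    using complete_filtration_inclusion by (intro exI)
  moreover have "\<forall>\<pi> :: ('g, 'w) top_rep. continuous_rep G X \<pi> \<and> irreducible_rep G \<pi> \<longrightarrow>
      multiplicity_of G R \<pi> < \<infinity>"
    by (intro allI impI multiplicity_finite) simp_all
  ultimately show ?thesis by (intro conjI)
qed

end
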